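(* For all $b\geq1$ and every real random variable $X$ with $\mathsf{E}X=0$, $\mathsf{E}X^2=1$, $\mathsf{E}|X|^3=b$ and characteristic function $f(t)=\mathsf{E}e^{itX}$, the following inequalities hold for all $t\in\mathbb{R}$: $$\left|f(t)-1+t^2/2\right|\leq b\gamma_3(b)\,|t|^3/6,$$ $$\left|f'(t)+t\right|\leq b\gamma_2(b)\,t^2/2,$$ $$\left|f''(t)+1\right|\leq b\gamma_1(b)\,|t|,$$ $$\left|f(t)-1\right|\leq \frac{1-\cos\theta_1^*}{\theta_1^*}\,\mathsf{E}|tX|\leq 0.7247\cdot|t|\,\mathsf{E}|X|,$$ where $$\gamma_n(b)=\min_{\lambda_*(n)\leq\lambda\leq\lambda^*(n)}\big(\lambda A(b)+q_n(\lambda)\big),\qquad n=1,2,3.$$ Moreover, for $n=1,2,3$, the functions $b\gamma_n(b)$ and $\gamma_n(b)$ are concave and strictly increasing in $b\geq1$, and $$q_n(\lambda^*(n))=\gamma_n(1)\leq\gamma_n(b)<\lim_{b\to\infty}\gamma_n(b)=1,\qquad b\geq1,\ n=1,2,3.$$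
   Context: For $n\in\{1,2,\ldots\}$ and $\lambda\geq0$, $$q_n(\lambda)=\sup_{x>0}\frac{n!}{x^n}\bigg|e^{ix}-\sum_{k=0}^{n-1}\frac{(ix)^k}{k!}-\lambda\frac{(ix)^n}{n!}\bigg|,$$ $$\lambda_*(n)=\sup\Big\{\lambda\geq0:\ \sup_{0\leq s\leq\lambda}(s+q_n(s))=1\Big\},\qquad \lambda^*(n)=\inf\Big\{\lambda\geq0:\ q_n(\lambda)=\inf_{s\geq0}q_n(s)\Big\}.$$ For $b\geq 1$, $$A(b)=\sqrt{\tfrac12\sqrt{1+8b^{-2}}+\tfrac12-2b^{-2}}.$$ The number $\theta_1^*=2.3311\ldots$ is the unique root of the equation $x\sin x+\cos x-1=0$ in the interval $(0,\pi)$. $\mathsf{E}$ denotes mathematical expectation. *)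

theory Defs
  imports "HOL-Probability.Probability"
begin

text \<open>All suprema and infima below are taken in \<^typ>\<open>real\<close>. For \<open>n \<ge> 1\<close> and \<open>\<lambda> \<ge> 0\<close> the set in
  \<open>taylor_q\<close> is bounded by \<open>1 + \<lambda>\<close>, because the Taylor remainder of \<open>exp (\<i> x)\<close> of order \<open>n\<close> is at
  most \<open>x ^ n / n!\<close> in modulus.\<close>

definition taylor_q :: "nat \<Rightarrow> real \<Rightarrow> real" where
  "taylor_q n l = (SUP x\<in>{0<..}. fact n / x ^ n *
     norm (exp (\<i> * of_real x) - (\<Sum>k<n. (\<i> * of_real x) ^ k / fact k)
           - of_real l * ((\<i> * of_real x) ^ n / fact n)))"

text \<open>The set in \<open>lambda_lower\<close> contains \<open>0\<close>, as \<open>taylor_q n 0 = 1\<close>, and is bounded by \<open>1\<close>, as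
  \<open>taylor_q\<close> is nonnegative.\<close>

definition lambda_lower :: "nat \<Rightarrow> real" where
  "lambda_lower n = Sup {l. 0 \<le> l \<and> (SUP s\<in>{0..l}. s + taylor_q n s) = 1}"

definition lambda_upper :: "nat \<Rightarrow> real" where
  "lambda_upper n = Inf {l. 0 \<le> l \<and> taylor_q n l = (INF s\<in>{0..}. taylor_q n s)}"

definition A_coeff :: "real \<Rightarrow> real" where
  "A_coeff b = sqrt (1 / 2 * sqrt (1 + 8 / b\<^sup>2) + 1 / 2 - 2 / b\<^sup>2)"

definition theta1 :: real where
  "theta1 = (THE x. 0 < x \<and> x < pi \<and> x * sin x + cos x - 1 = 0)"

text \<open>The minimum over \<open>[lambda_lower n, lambda_upper n]\<close> is written as an infimum; that it is
  attained has to be stated separately.\<close>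

definition gamma_coeff :: "nat \<Rightarrow> real \<Rightarrow> real" where
  "gamma_coeff n b =
     (INF l\<in>{lambda_lower n..lambda_upper n}. l * A_coeff b + taylor_q n l)"

end

theory Submission
  imports Defs
begin

text \<open>With \<open>R\<close> the Taylor remainder of \<open>exp (\<i> x)\<close> of order \<open>n\<close>, split
  \<open>E X ^ (3 - n) R (t X)\<close> into \<open>E X ^ (3 - n) (R (t X) - l (\<i> t X) ^ n / n!)\<close>, which \<open>q n l\<close>
  controls, and a multiple of \<open>l E X\<^sup>3\<close>, which the sharp bound \<open>\<bar>E X\<^sup>3\<bar> \<le> b A b\<close> controls; then
  choose the best \<open>l\<close>. The sharp bound integrates a majorant of \<open>x\<^sup>3\<close> in the span of
  \<open>\<bar>x\<bar>\<^sup>3, x\<^sup>2, x, 1\<close> that touches at the two atoms of the extremal distribution. The same linear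
  majorants exhibit \<open>b A b\<close> as an infimum of affine functions of \<open>b\<close> and \<open>A b\<close> as an infimum of affine
  functions of \<open>- 1 / b\<close>, whence concavity. Strict monotonicity and \<open>\<gamma> < 1\<close> rest on
  \<open>\<lambda>\<^sub>* > 0\<close>.\<close>

subsection \<open>Taylor remainders of the exponential\<close>

text \<open>After division by \<open>(\<i> x) ^ n / n!\<close> the remainder traces a curve in the
  closed unit disc that starts at 1, and \<open>q n l\<close> is the largest distance (a supremum)
  from the real point \<open>l\<close> to it. Hence \<open>q n l \<ge> 1 - l\<close> always.
  Equality means that the disc of centre \<open>l\<close> and radius \<open>1 - l\<close>,
  internally tangent to the unit circle at 1, contains the curve; \<open>lambda_lower n\<close> is
  the last centre up to which this persists. The obstacle is that the curve itself leaves 1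
  tangentially to the unit circle. That some positive \<open>l\<close> works is therefore a
  curvature comparison near 1, combined with a uniform gap from the circle far from it; the weight
  \<open>x\<^sup>2 / (1 + x\<^sup>2)\<close> treats both regimes at once. The nested roots in
  \<open>A b\<close> disappear once \<open>b\<close> is written as the third absolute moment of a
  two-point law. At \<open>b = 1\<close> this law is symmetric and the tangent to
  \<open>b A b\<close> is vertical, which forces a separate case in the concavity proof and a
  perturbation in the moment bound.\<close>

definition taylor_rem :: "nat \<Rightarrow> real \<Rightarrow> complex" where
  "taylor_rem n x = exp (\<i> * of_real x) - (\<Sum>k<n. (\<i> * of_real x) ^ k / fact k)"

definition taylor_ratio :: "nat \<Rightarrow> real \<Rightarrow> complex" where
  "taylor_ratio n x = fact n * taylor_rem n x / (\<i> * of_real x) ^ n"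

lemma taylor_rem_Suc: "taylor_rem (Suc n) x = taylor_rem n x - (\<i> * of_real x) ^ n / fact n"
  by (simp add: taylor_rem_def)

lemma taylor_rem_0_right: "taylor_rem (Suc n) 0 = 0"
  by (simp add: taylor_rem_def sum.lessThan_Suc_shift del: sum.lessThan_Suc)

lemma cnj_taylor_rem: "cnj (taylor_rem n x) = taylor_rem n (-x)"
  by (simp add: taylor_rem_def exp_cnj)

lemma norm_taylor_rem_le: "norm (taylor_rem n x) \<le> \<bar>x\<bar> ^ n / fact n"
proof (cases n)
  case 0
  then show ?thesis by (simp add: taylor_rem_def)
next
  case (Suc m)
  then show ?thesis
    using iexp_approx1[of x m] by (simp add: taylor_rem_def lessThan_Suc_atMost)
qed

lemma has_vector_derivative_taylor_rem:
  "(taylor_rem (Suc n) has_vector_derivative \<i> * taylor_rem n x) (at x)"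
proof (induction n)
  case 0
  show ?case
    unfolding taylor_rem_def
    by (auto intro!: derivative_eq_intros has_vector_derivative_real_field)
next
  case (Suc n)
  have "((\<lambda>x. (\<i> * of_real x) ^ Suc n / fact (Suc n)) has_vector_derivative
      \<i> * ((\<i> * of_real x) ^ n / fact n)) (at x)"
  proof (rule has_vector_derivative_real_field)
    have "((\<lambda>z. (\<i> * z) ^ Suc n / fact (Suc n)) has_field_derivative
        of_nat (Suc n) * (\<i> * of_real x) ^ n * \<i> / fact (Suc n)) (at (of_real x))"
      by (auto intro!: derivative_eq_intros simp del: of_nat_Suc power_Suc)
    also have "of_nat (Suc n) * (\<i> * of_real x) ^ n * \<i> / fact (Suc n) = \<i> * ((\<i> * of_real x) ^ n / fact n)"
      by (simp del: of_nat_Suc)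
    finally show "((\<lambda>z. (\<i> * z) ^ Suc n / fact (Suc n)) has_field_derivative
        \<i> * ((\<i> * of_real x) ^ n / fact n)) (at (of_real x))" .
  qed
  from has_vector_derivative_diff[OF Suc this]
  show ?case
    by (simp add: taylor_rem_Suc[of "Suc n", abs_def] taylor_rem_Suc[of n] right_diff_distrib
        del: power_Suc fact_Suc)
qed

text \<open>Base case of \<open>norm_taylor_rem_sharp\<close>, with \<open>x = 2 y\<close> and
  \<open>norm (exp (\<i> x) - 1) = 2 \<bar>sin (x / 2)\<bar>\<close>. For \<open>y \<le> 2\<close>
  the factor 1/30 is what the expansion leaves: \<open>y ^ 5 / 120 \<le> y ^ 3 / 30\<close> and
  \<open>1/6 - 1/30 = 4/30\<close>, to be compared with \<open>g \<le> 4 y\<^sup>2\<close>. For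
  \<open>y > 2\<close> the trivial bound 1 suffices.\<close>

lemma abs_sin_le_sharp:
  assumes "0 \<le> (y::real)"
  shows "\<bar>sin y\<bar> \<le> y * (1 - 1 / 30 * ((2 * y)\<^sup>2 / (1 + (2 * y)\<^sup>2)))"
proof -
  define g where "g = (2 * y)\<^sup>2 / (1 + (2 * y)\<^sup>2)"
  have g: "0 \<le> g" "g \<le> 1" "g \<le> 4 * y\<^sup>2"
    by (auto simp: g_def divide_simps add_pos_nonneg) (auto simp: field_simps)
  show ?thesis
  proof (cases "y \<le> 2")
    case True
    have "sin y \<ge> 0"
      using assms True pi_gt3 by (intro sin_ge_zero) auto
    moreover have "sin y \<le> y - y ^ 3 / 6 + y ^ 5 / 120"
    proof -
      have "(\<Sum>m<5. sin_coeff m * y ^ m) = y - y ^ 3 / 6"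
        by (simp add: lessThan_nat_numeral lessThan_Suc sin_coeff_def fact_numeral)
      moreover have "inverse (fact 5) * \<bar>y\<bar> ^ 5 = y ^ 5 / 120"
        using assms by (simp add: fact_numeral field_simps)
      ultimately show ?thesis
        using Maclaurin_sin_bound[of y 5] by linarith
    qed
    moreover have "y ^ 3 * y\<^sup>2 \<le> y ^ 3 * 4"
      using True assms power_mono[of y 2 2] by (intro mult_left_mono) auto
    moreover have "y * g \<le> y * (4 * y\<^sup>2)"
      using g assms by (intro mult_left_mono) auto
    ultimately have "\<bar>sin y\<bar> \<le> y * (1 - 1 / 30 * g)"
      by (simp add: algebra_simps eval_nat_numeral)
    then show ?thesis by (simp add: g_def)
  next
    case False
    have "\<bar>sin y\<bar> \<le> 1" by simp
    also have "\<dots> \<le> y * (1 - 1 / 30)" using False by simp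
    also have "\<dots> \<le> y * (1 - 1 / 30 * g)"
      using g assms by (intro mult_left_mono) auto
    finally show ?thesis by (simp add: g_def)
  qed
qed

text \<open>The quantitative form of "strictly inside the unit circle" needed for
  \<open>taylor_q_near_zero\<close>. Since the derivative of the remainder of order
  \<open>n + 1\<close> has the modulus of the remainder of order \<open>n\<close>, the induction
  integrates the bound, at the price of a smaller constant.\<close>

lemma norm_taylor_rem_sharp:
  assumes "n \<ge> 1"
  shows "\<exists>c>0. \<forall>x\<ge>0. norm (taylor_rem n x) \<le> x ^ n / fact n * (1 - c * (x\<^sup>2 / (1 + x\<^sup>2)))"
  using assms
proof (induction n rule: dec_induct)
  case base
  show ?case
  proof (intro exI[of _ "1/30"] conjI allI impI)
    fix x :: real assume "0 \<le> x"
    then show "norm (taylor_rem 1 x) \<le> x ^ 1 / fact 1 * (1 - 1 / 30 * (x\<^sup>2 / (1 + x\<^sup>2)))"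
      using abs_sin_le_sharp[of "x / 2"] by (simp add: taylor_rem_def dist_exp_i_1)
  qed simp
next
  case (step n)
  then obtain c where c: "c > 0"
    and B: "\<And>x. 0 \<le> x \<Longrightarrow> norm (taylor_rem n x) \<le> x ^ n / fact n * (1 - c * (x\<^sup>2 / (1 + x\<^sup>2)))"
    by blast
  \<comment> \<open>In \<open>\<phi>'\<close> the weight costs \<open>d\<close> times itself, and
    its derivative costs at most \<open>2 * d\<close> times the weight, relative to
    \<open>x ^ n / fact n\<close>. The total is \<open>3 * d = c\<close>.\<close>
  define d where "d = c / 3"
  define \<phi> where "\<phi> = (\<lambda>x::real. x ^ Suc n / fact (Suc n) * (1 - d * (x\<^sup>2 / (1 + x\<^sup>2))))"
  define \<phi>' where "\<phi>' = (\<lambda>x::real. x ^ n / fact n * (1 - d * (x\<^sup>2 / (1 + x\<^sup>2)))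
     - x ^ Suc n / fact (Suc n) * (d * (2 * x / (1 + x\<^sup>2)\<^sup>2)))"
  have pos: "1 + x\<^sup>2 \<noteq> (0::real)" for x
    by (metis add_pos_nonneg less_numeral_extra(1,3) zero_le_power2)
  have der: "(\<phi> has_vector_derivative \<phi>' x) (at x)" for x
  proof -
    have 1: "((\<lambda>x. x ^ Suc n / fact (Suc n)) has_field_derivative x ^ n / fact n) (at x)"
      by (rule DERIV_cong[OF DERIV_cdivide[OF DERIV_pow]]) (simp del: of_nat_Suc)
    have 2: "((\<lambda>x. 1 - d * (x\<^sup>2 / (1 + x\<^sup>2))) has_field_derivative - (d * (2 * x / (1 + x\<^sup>2)\<^sup>2))) (at x)"
      by (rule derivative_eq_intros refl pos)+
         (use pos[of x] in \<open>simp add: divide_simps, simp add: algebra_simps power2_eq_square\<close>)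
    show ?thesis
      unfolding \<phi>_def \<phi>'_def has_real_derivative_iff_has_vector_derivative[symmetric]
      by (rule DERIV_cong[OF DERIV_mult[OF 1 2]]) (simp del: power_Suc fact_Suc add: mult_ac)
  qed
  show ?case
  proof (intro exI[of _ d] conjI allI impI)
    fix x :: real assume x: "0 \<le> x"
    show "norm (taylor_rem (Suc n) x) \<le> x ^ Suc n / fact (Suc n) * (1 - d * (x\<^sup>2 / (1 + x\<^sup>2)))"
    proof (cases "x = 0")
      case True then show ?thesis by (simp add: taylor_rem_0_right)
    next
      case False
      with x have "0 < x" by simp
      have "norm (taylor_rem (Suc n) x - taylor_rem (Suc n) 0) \<le> \<phi> x - \<phi> 0"
      proof (rule differentiable_bound_general[OF \<open>0 < x\<close>])
        fix y assume y: "0 < y" "y < x"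
        show "(taylor_rem (Suc n) has_vector_derivative \<i> * taylor_rem n y) (at y)"
          by (rule has_vector_derivative_taylor_rem)
        show "(\<phi> has_vector_derivative \<phi>' y) (at y)" by (rule der)
        have "y\<^sup>2 / (1 + y\<^sup>2)\<^sup>2 \<le> y\<^sup>2 / (1 + y\<^sup>2)"
          using mult_left_mono[of 1 "1 + y\<^sup>2" "(1 + y\<^sup>2)"]
          by (intro divide_left_mono) (auto simp: power2_eq_square add_pos_nonneg)
        moreover have "y\<^sup>2 / (1 + y\<^sup>2)\<^sup>2 / (1 + n) \<le> y\<^sup>2 / (1 + y\<^sup>2)\<^sup>2"
          using divide_left_mono[of 1 "1 + real n" "y\<^sup>2 / (1 + y\<^sup>2)\<^sup>2"] by simp
        ultimately have "2 * d * (y\<^sup>2 / (1 + y\<^sup>2)\<^sup>2 / (1 + n)) \<le> 2 * d * (y\<^sup>2 / (1 + y\<^sup>2))"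
          using c by (intro mult_left_mono) (auto simp: d_def)
        moreover have "1 - c * p \<le> 1 - d * p - 2 * d * q" if "2 * d * q \<le> 2 * d * p" for p q
          using that by (simp add: d_def)
        ultimately have *: "1 - c * (y\<^sup>2 / (1 + y\<^sup>2))
            \<le> 1 - d * (y\<^sup>2 / (1 + y\<^sup>2)) - 2 * d * (y\<^sup>2 / (1 + y\<^sup>2)\<^sup>2 / (1 + n))"
          by blast
        have "norm (\<i> * taylor_rem n y) \<le> y ^ n / fact n * (1 - c * (y\<^sup>2 / (1 + y\<^sup>2)))"
          using B[of y] y by (simp add: norm_mult)
        also have "\<dots> \<le> y ^ n / fact n * (1 - d * (y\<^sup>2 / (1 + y\<^sup>2)) - 2 * d * (y\<^sup>2 / (1 + y\<^sup>2)\<^sup>2 / (1 + n)))"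
          using y by (intro mult_left_mono[OF *]) auto
        also have "\<dots> = \<phi>' y"
          by (simp add: \<phi>'_def power2_eq_square right_diff_distrib mult_ac)
        finally show "norm (\<i> * taylor_rem n y) \<le> \<phi>' y" .
      next
        show "continuous_on {0..x} (taylor_rem (Suc n))"
          using has_vector_derivative_taylor_rem has_vector_derivative_continuous
          by (blast intro: continuous_at_imp_continuous_on)
        show "continuous_on {0..x} \<phi>"
          using der has_vector_derivative_continuous
          by (blast intro: continuous_at_imp_continuous_on)
      qed
      then show ?thesis by (simp add: taylor_rem_0_right \<phi>_def)
    qed
  qed (use c d_def in auto)
qed

subsection \<open>The functions q\<close>

lemma taylor_rem_ratio:
  assumes "x \<noteq> 0"
  shows "taylor_rem n x = taylor_ratio n x * (\<i> * of_real x) ^ n / fact n"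
  using assms by (simp add: taylor_ratio_def)

lemma norm_taylor_ratio_diff:
  assumes "0 < x"
  shows "fact n / x ^ n * norm (taylor_rem n x - of_real l * ((\<i> * of_real x) ^ n / fact n))
    = norm (taylor_ratio n x - of_real l)"
proof -
  have "taylor_rem n x - of_real l * ((\<i> * of_real x) ^ n / fact n)
    = (taylor_ratio n x - of_real l) * ((\<i> * of_real x) ^ n / fact n)"
    using assms by (simp add: taylor_rem_ratio left_diff_distrib diff_divide_distrib)
  then show ?thesis
    using assms by (simp add: norm_mult norm_divide norm_power)
qed

lemma taylor_q_eq: "taylor_q n l = (SUP x\<in>{0<..}. norm (taylor_ratio n x - of_real l))"
  unfolding taylor_q_def
  by (intro SUP_cong refl) (simp only: norm_taylor_ratio_diff greaterThan_iff flip: taylor_rem_def)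

lemma norm_taylor_ratio_le:
  assumes "0 < x"
  shows "norm (taylor_ratio n x) \<le> 1"
  using norm_taylor_rem_le[of n x] assms
  by (simp add: taylor_ratio_def norm_mult norm_divide norm_power field_simps)

lemma norm_taylor_ratio_diff_le_q:
  assumes "0 < x"
  shows "norm (taylor_ratio n x - of_real l) \<le> taylor_q n l"
  unfolding taylor_q_eq
proof (rule cSUP_upper)
  show "bdd_above ((\<lambda>x. norm (taylor_ratio n x - of_real l)) ` {0<..})"
  proof (rule bdd_aboveI2)
    fix x :: real assume "x \<in> {0<..}"
    then show "norm (taylor_ratio n x - of_real l) \<le> 1 + \<bar>l\<bar>"
      using norm_triangle_ineq4[of "taylor_ratio n x" "of_real l"] norm_taylor_ratio_le[of x n]
      by simp
  qed
qed (use assms in simp)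

lemma taylor_q_leI:
  assumes "\<And>x. 0 < x \<Longrightarrow> norm (taylor_ratio n x - of_real l) \<le> c"
  shows "taylor_q n l \<le> c"
  unfolding taylor_q_eq using assms gt_ex by (intro cSUP_least) auto

text \<open>The supremum in \<open>taylor_q\<close> sees only positive \<open>x\<close>. Negative
  \<open>x\<close> follows by conjugation, because \<open>l\<close> is real, and at
  \<open>x = 0\<close> both sides vanish because \<open>n \<ge> 1\<close>.\<close>

lemma norm_taylor_rem_diff_le:
  assumes "n \<ge> 1"
  shows "norm (taylor_rem n x - of_real l * ((\<i> * of_real x) ^ n / fact n))
    \<le> taylor_q n l * (\<bar>x\<bar> ^ n / fact n)"
proof -
  have pos: "norm (taylor_rem n x - of_real l * ((\<i> * of_real x) ^ n / fact n))
    \<le> taylor_q n l * (\<bar>x\<bar> ^ n / fact n)" if "x > 0" for x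
  proof -
    have "fact n / x ^ n * norm (taylor_rem n x - of_real l * ((\<i> * of_real x) ^ n / fact n)) \<le> taylor_q n l"
      using norm_taylor_ratio_diff_le_q[OF that] norm_taylor_ratio_diff[OF that] by simp
    then show ?thesis using that by (simp add: field_simps)
  qed
  consider "x > 0" | "x = 0" | "x < 0" by linarith
  then show ?thesis
  proof cases
    case 1 then show ?thesis by (rule pos)
  next
    case 2
    with assms show ?thesis
      using taylor_rem_0_right[of "n - 1"] by (simp add: power_0_left)
  next
    case 3
    have "norm (taylor_rem n x - of_real l * ((\<i> * of_real x) ^ n / fact n))
      = norm (cnj (taylor_rem n (-x) - of_real l * ((\<i> * of_real (-x)) ^ n / fact n)))"
      by (simp add: cnj_taylor_rem)
    then show ?thesis using pos[of "-x"] 3 by (simp only: complex_mod_cnj abs_minus)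
  qed
qed

lemma taylor_q_lipschitz: "taylor_q n l \<le> taylor_q n m + \<bar>l - m\<bar>"
proof (rule taylor_q_leI)
  fix x :: real assume "0 < x"
  have "norm (taylor_ratio n x - of_real l) \<le> norm (taylor_ratio n x - of_real m) + norm (of_real m - of_real l :: complex)"
    using norm_triangle_ineq[of "taylor_ratio n x - of_real m" "of_real m - of_real l"] by simp
  also have "norm (of_real m - of_real l :: complex) = \<bar>l - m\<bar>"
    by (simp flip: of_real_diff)
  finally show "norm (taylor_ratio n x - of_real l) \<le> taylor_q n m + \<bar>l - m\<bar>"
    using norm_taylor_ratio_diff_le_q[OF \<open>0 < x\<close>, of n m] by linarith
qed

lemma continuous_on_taylor_q: "continuous_on S (taylor_q n)"
proof -
  have "dist (taylor_q n l) (taylor_q n m) \<le> 1 * dist l m" for l m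
    using taylor_q_lipschitz[of n l m] taylor_q_lipschitz[of n m l]
    by (simp add: dist_real_def)
  then have "1-lipschitz_on S (taylor_q n)" by (intro lipschitz_onI) auto
  then show ?thesis by (rule lipschitz_on_continuous_on)
qed

lemma taylor_q_nonneg: "0 \<le> taylor_q n l"
  using norm_taylor_ratio_diff_le_q[of 1 n l] norm_ge_zero order_trans zero_less_one by blast

lemma taylor_q_zero_le: "taylor_q n 0 \<le> 1"
  by (rule taylor_q_leI) (simp add: norm_taylor_ratio_le)

lemma norm_taylor_ratio_minus_1:
  assumes "0 < x"
  shows "norm (taylor_ratio n x - 1) \<le> x"
proof -
  have "taylor_ratio n x - 1 = fact n * taylor_rem (Suc n) x / (\<i> * of_real x) ^ n"
    using assms by (simp add: taylor_ratio_def taylor_rem_Suc field_simps)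
  also have "norm \<dots> = fact n * norm (taylor_rem (Suc n) x) / x ^ n"
    using assms by (simp add: norm_mult norm_divide norm_power)
  also have "\<dots> \<le> fact n * (x ^ Suc n / fact (Suc n)) / x ^ n"
    using norm_taylor_rem_le[of "Suc n" x] assms
    by (intro divide_right_mono mult_left_mono) auto
  also have "\<dots> = x / Suc n" using assms by (simp del: of_nat_Suc)
  also have "\<dots> \<le> x" using assms by (simp add: field_simps)
  finally show ?thesis .
qed

text \<open>The curve of ratios tends to 1 as \<open>x\<close> tends to 0, so the supremum is at
  least the distance from \<open>l\<close> to 1.\<close>

lemma taylor_q_ge: "1 - l \<le> taylor_q n l"
proof (rule field_le_epsilon)
  fix e :: real assume e: "0 < e"
  have "norm (1 - of_real l :: complex) = \<bar>1 - l\<bar>"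
    by (metis norm_of_real of_real_1 of_real_diff)
  then show "1 - l \<le> taylor_q n l + e"
    using norm_triangle_ineq4[of "taylor_ratio n e - of_real l" "taylor_ratio n e - 1"]
      norm_taylor_ratio_diff_le_q[OF e, of n l] norm_taylor_ratio_minus_1[OF e, of n] by simp
qed

text \<open>A single point of the curve, at \<open>x = 1\<close>, already gives this, since it lies
  in the unit disc. It confines the search for a minimiser to a compact interval.\<close>

lemma taylor_q_coercive: "l - 1 \<le> taylor_q n l"
  using norm_triangle_ineq4[of "taylor_ratio n 1" "taylor_ratio n 1 - of_real l"]
    norm_taylor_ratio_diff_le_q[of 1 n l] norm_taylor_ratio_le[of 1 n] by simp

text \<open>The first order term \<open>\<i> x / (n + 1)\<close> of the ratio is imaginary, so the
  real part deviates from 1 only to second order. The factor 3 fits both ranges: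
  \<open>1 + x\<^sup>2 \<le> 3\<close> if \<open>x\<^sup>2 \<le> 2\<close>, and otherwise the left
  side is at most -1.\<close>

lemma Re_taylor_ratio_ge:
  assumes "0 < x"
  shows "1 - 3 * (x\<^sup>2 / (1 + x\<^sup>2)) \<le> Re (taylor_ratio n x)"
proof (cases "x\<^sup>2 \<le> 2")
  case True
  have "taylor_ratio n x - 1 = fact n * taylor_rem (Suc (Suc n)) x / (\<i> * of_real x) ^ n
      + \<i> * of_real (x / Suc n)"
    using assms by (simp add: taylor_ratio_def taylor_rem_Suc field_simps del: of_nat_Suc)
  then have "1 - Re (taylor_ratio n x) = - Re (fact n * taylor_rem (Suc (Suc n)) x / (\<i> * of_real x) ^ n)"
    by (simp add: complex_eq_iff del: of_nat_Suc)
  also have "\<dots> \<le> norm (fact n * taylor_rem (Suc (Suc n)) x / (\<i> * of_real x) ^ n)"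
    using abs_Re_le_cmod by (meson abs_le_D2)
  also have "\<dots> = fact n * norm (taylor_rem (Suc (Suc n)) x) / x ^ n"
    using assms by (simp add: norm_mult norm_divide norm_power)
  also have "\<dots> \<le> fact n * (x ^ Suc (Suc n) / fact (Suc (Suc n))) / x ^ n"
    using norm_taylor_rem_le[of "Suc (Suc n)" x] assms
    by (intro divide_right_mono mult_left_mono) auto
  also have "\<dots> = x\<^sup>2 / (real (Suc n) * real (Suc (Suc n)))"
    using assms by (simp add: power2_eq_square del: of_nat_Suc)
  also have "\<dots> \<le> x\<^sup>2 / 1"
    by (intro divide_left_mono mult_pos_pos) (auto simp: algebra_simps)
  also have "x\<^sup>2 / 1 \<le> 3 * (x\<^sup>2 / (1 + x\<^sup>2))"
    using assms mult_left_mono[OF True, of "x\<^sup>2"] by (simp add: field_simps add_pos_nonneg)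
  finally show ?thesis by simp
next
  case False
  then have "2 \<le> 3 * (x\<^sup>2 / (1 + x\<^sup>2))" by (simp add: field_simps)
  moreover have "-1 \<le> Re (taylor_ratio n x)"
    using norm_taylor_ratio_le[OF assms, of n] abs_Re_le_cmod[of "taylor_ratio n x"] by linarith
  ultimately show ?thesis by linarith
qed

text \<open>Both \<open>1 - |z|\<^sup>2\<close> and \<open>1 - Re z\<close> are comparable to \<open>x\<^sup>2 / (1 + x\<^sup>2)\<close> along the curve of
  ratios \<open>z\<close>, so the curve stays in a disc of centre \<open>l\<close> and radius \<open>1 - l\<close>.\<close>

lemma taylor_q_near_zero:
  assumes "n \<ge> 1"
  shows "\<exists>e>0. \<forall>l. 0 \<le> l \<and> l \<le> e \<longrightarrow> taylor_q n l \<le> 1 - l"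
proof -
  obtain c where c: "c > 0"
    and B: "\<And>x. 0 \<le> x \<Longrightarrow> norm (taylor_rem n x) \<le> x ^ n / fact n * (1 - c * (x\<^sup>2 / (1 + x\<^sup>2)))"
    using norm_taylor_rem_sharp[OF assms] by blast
  show ?thesis
  \<comment> \<open>With \<open>g\<close> the weight, \<open>1 - norm z\<close> is at least
    \<open>c * g\<close> while \<open>1 - Re z\<close> is at most \<open>3 * g\<close>. Expanding
    the square of \<open>norm (z - l)\<close> requires \<open>2 * l * 3 * g \<le> c * g\<close>,
    hence \<open>c / 6\<close>; the bound 1 keeps the radius \<open>1 - l\<close>
    nonnegative.\<close>
  proof (intro exI[of _ "min 1 (c / 6)"] conjI allI impI)
    fix l assume l: "0 \<le> l \<and> l \<le> min 1 (c / 6)"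
    show "taylor_q n l \<le> 1 - l"
    proof (rule taylor_q_leI)
      fix x :: real assume x: "0 < x"
      define g where "g = x\<^sup>2 / (1 + x\<^sup>2)"
      define z where "z = taylor_ratio n x"
      have g: "0 \<le> g" by (simp add: g_def)
      have z: "norm z \<le> 1 - c * g"
        using B[of x] x
        by (simp add: z_def g_def taylor_ratio_def norm_mult norm_divide norm_power field_simps)
      have z1: "norm z \<le> 1" using x by (simp add: z_def norm_taylor_ratio_le)
      have "(norm z)\<^sup>2 \<le> norm z"
        using z1 by (simp add: power2_eq_square mult_left_le)
      moreover have "2 * l * (1 - 3 * g) \<le> 2 * l * Re z"
        using Re_taylor_ratio_ge[OF x, of n] l unfolding g_def z_def by (intro mult_left_mono) auto
      moreover have "6 * l * g \<le> c * g"
        using l g by (intro mult_right_mono) auto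
      moreover have "(norm (z - of_real l))\<^sup>2 = (norm z)\<^sup>2 - 2 * l * Re z + l\<^sup>2"
        by (simp add: cmod_power2) (simp add: power2_eq_square algebra_simps)
      ultimately have "(norm (z - of_real l))\<^sup>2 \<le> (1 - l)\<^sup>2"
        using z by (simp add: power2_eq_square algebra_simps)
      then show "norm (taylor_ratio n x - of_real l) \<le> 1 - l"
        unfolding z_def by (rule power2_le_imp_le) (use l in auto)
    qed
  qed (use c in auto)
qed

section \<open>The endpoints of the interval of admissible centres\<close>

lemma lambda_upper_props:
  shows "0 \<le> lambda_upper n"
    and "0 \<le> l \<Longrightarrow> taylor_q n (lambda_upper n) \<le> taylor_q n l"
proof -
  define S where "S = {l. 0 \<le> l \<and> taylor_q n l = (INF s\<in>{0..}. taylor_q n s)}"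
  \<comment> \<open>Beyond 2 the coercive bound exceeds 1, which is at least
    \<open>taylor_q n 0\<close>, so a minimiser on \<open>{0..2}\<close> is global on the
    half-line.\<close>
  obtain m where m: "m \<in> {0..2}" "\<And>l. l \<in> {0..2} \<Longrightarrow> taylor_q n m \<le> taylor_q n l"
    using continuous_attains_inf[OF compact_Icc _ continuous_on_taylor_q, of "0::real" 2] by force
  have min: "taylor_q n m \<le> taylor_q n l" if "0 \<le> l" for l
  proof (cases "l \<le> 2")
    case False
    have "taylor_q n m \<le> 1" using m(2)[of 0] taylor_q_zero_le[of n] by simp
    then show ?thesis using False taylor_q_coercive[of l n] by simp
  qed (use m that in simp)
  have bdd: "bdd_below (taylor_q n ` {0..})" using min by (intro bdd_belowI2) auto
  have INF: "(INF s\<in>{0..}. taylor_q n s) = taylor_q n m"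
    using m min by (intro antisym cINF_lower[OF bdd] cINF_greatest) auto
  have "closed {l. 0 \<le> l \<and> taylor_q n l = taylor_q n m}"
    by (intro closed_Collect_conj closed_Collect_le closed_Collect_eq continuous_intros
        continuous_on_taylor_q)
  then have "closed S" by (simp add: S_def INF)
  moreover have "S \<noteq> {}" using m INF by (auto simp: S_def)
  moreover have "bdd_below S" by (auto simp: S_def intro!: bdd_belowI[of _ 0])
  ultimately have "Inf S \<in> S" by (intro closed_contains_Inf) auto
  then have *: "lambda_upper n \<in> S" by (simp add: lambda_upper_def S_def)
  show "0 \<le> lambda_upper n" using * by (simp add: S_def)
  show "taylor_q n (lambda_upper n) \<le> taylor_q n l" if "0 \<le> l"
    using * min[OF that] by (simp add: S_def INF)
qed

text \<open>As \<open>s + taylor_q n s\<close> is never below 1, its supremum equals 1 exactly when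
  it is constantly 1 on \<open>{0..l}\<close>. Positivity is \<open>taylor_q_near_zero\<close>; the
  equality survives at the supremum by the Lipschitz bound. The endpoints are in order because
  \<open>1 - lambda_upper n \<le> taylor_q n (lambda_upper n) \<le> taylor_q n (lambda_lower
  n)\<close>.\<close>

lemma lambda_lower_props:
  assumes "n \<ge> 1"
  shows "0 < lambda_lower n" and "taylor_q n (lambda_lower n) = 1 - lambda_lower n"
    and "lambda_lower n \<le> lambda_upper n"
proof -
  define S where "S = {l. 0 \<le> l \<and> (SUP s\<in>{0..l}. s + taylor_q n s) = 1}"
  have S_q: "taylor_q n l \<le> 1 - l" if "l \<in> S" for l
  proof -
    have "l + taylor_q n l \<le> (SUP s\<in>{0..l}. s + taylor_q n s)"
    proof (rule cSUP_upper)
      show "bdd_above ((\<lambda>s. s + taylor_q n s) ` {0..l})"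
        by (intro bounded_imp_bdd_above compact_imp_bounded compact_continuous_image
            continuous_intros continuous_on_taylor_q compact_Icc)
    qed (use that S_def in auto)
    then show ?thesis using that by (simp add: S_def)
  qed
  obtain e where e: "e > 0" "\<And>l. 0 \<le> l \<Longrightarrow> l \<le> e \<Longrightarrow> taylor_q n l \<le> 1 - l"
    using taylor_q_near_zero[OF assms] by blast
  have "(SUP s\<in>{0..e}. s + taylor_q n s) = 1"
  proof -
    have "s + taylor_q n s = 1" if "s \<in> {0..e}" for s
      using that e(2)[of s] taylor_q_ge[of s n] by simp
    then show ?thesis using e(1) by (simp cong: SUP_cong_simp)
  qed
  then have eS: "e \<in> S" using e by (simp add: S_def)
  have le1: "l \<le> 1" if "l \<in> S" for l using S_q[OF that] taylor_q_nonneg[of n l] by simp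
  have bdd: "bdd_above S" using le1 by (intro bdd_aboveI) auto
  have L: "lambda_lower n = Sup S" by (simp add: lambda_lower_def S_def)
  have "e \<le> Sup S" using bdd eS by (intro cSup_upper)
  then show "0 < lambda_lower n" using e L by simp
  have "taylor_q n (Sup S) \<le> 1 - Sup S"
  proof (rule field_le_epsilon)
    fix d :: real assume "0 < d"
    then have "Sup S - d / 2 < Sup S" by simp
    then obtain l where l: "l \<in> S" "Sup S - d / 2 < l"
      using less_cSupE eS by (metis empty_iff)
    then have "l \<le> Sup S" using bdd by (intro cSup_upper)
    then show "taylor_q n (Sup S) \<le> 1 - Sup S + d"
      using S_q[OF l(1)] l(2) taylor_q_lipschitz[of n "Sup S" l] by simp
  qed
  then show q: "taylor_q n (lambda_lower n) = 1 - lambda_lower n"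
    using taylor_q_ge[of "lambda_lower n" n] L by simp
  show "lambda_lower n \<le> lambda_upper n"
    using q lambda_upper_props(2)[of "lambda_lower n" n] taylor_q_ge[of "lambda_upper n" n]
      \<open>0 < lambda_lower n\<close> by simp
qed

subsection \<open>The sharp bound for the third moment\<close>

text \<open>The random variable with values \<open>u\<close> and \<open>- 1 / u\<close> of mean zero and variance one has third
  absolute moment \<open>third_abs u\<close> and third moment \<open>u - 1 / u\<close>; it is extremal for the bound
  \<open>\<bar>E X\<^sup>3\<bar> \<le> b * A_coeff b\<close>.\<close>

definition third_abs :: "real \<Rightarrow> real" where
  "third_abs u = (u ^ 4 + 1) / (u * (u\<^sup>2 + 1))"

lemma third_abs_1 [simp]: "third_abs 1 = 1"
  by (simp add: third_abs_def)

lemma third_abs_mono: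
  assumes "1 \<le> u" "u \<le> v"
  shows "third_abs u \<le> third_abs v"
proof -
  have "1 \<le> u * v" using mult_mono[of 1 u 1 v] assms by simp
  moreover have "1 \<le> u ^ 3 * v ^ 3"
    using power_mono[OF \<open>1 \<le> u * v\<close>, of 3] by (simp add: power_mult_distrib)
  \<comment> \<open>This product is the cross-multiplied difference of the two values, with the
    factor \<open>v - u\<close> extracted; \<open>u * v \<ge> 1\<close> makes the other factor
    nonnegative.\<close>
  ultimately have "0 \<le> (v - u) * ((u ^ 3 * v ^ 3 - 1) + (u * v - 1) * (v\<^sup>2 + u * v + u\<^sup>2))"
    using assms by (intro mult_nonneg_nonneg add_nonneg_nonneg) auto
  then have "(u ^ 4 + 1) * (v * (v\<^sup>2 + 1)) \<le> (v ^ 4 + 1) * (u * (u\<^sup>2 + 1))"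
    by (simp add: algebra_simps eval_nat_numeral)
  then show ?thesis
    using assms by (simp add: third_abs_def divide_simps add_pos_nonneg)
qed

text \<open>Lets every statement about \<open>A_coeff b\<close> be proved in the parameter
  \<open>u\<close>, in which it is rational. The point \<open>2 * b\<close> serves as upper end for
  the intermediate value theorem.\<close>

lemma third_abs_surj:
  assumes "1 \<le> b"
  obtains u where "1 \<le> u" "b = third_abs u"
proof -
  have "continuous_on {1..2 * b} third_abs"
    unfolding third_abs_def
    by (intro continuous_intros) (auto simp: add_nonneg_eq_0_iff)
  moreover have "b \<le> third_abs (2 * b)"
  proof -
    have "1 \<le> 4 * b\<^sup>2" using power_mono[OF assms, of 2] by simp
    then have "b * (2 * b * ((2 * b)\<^sup>2 + 1)) \<le> (2 * b) ^ 4 + 1"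
      using mult_left_mono[of 1 "4 * b\<^sup>2" "2 * b\<^sup>2"] by (simp add: algebra_simps eval_nat_numeral)
    then show ?thesis using assms by (simp add: third_abs_def pos_le_divide_eq add_pos_nonneg)
  qed
  ultimately show ?thesis
    using IVT'[of third_abs 1 b "2 * b"] assms that by auto
qed

text \<open>In terms of \<open>u\<close> both radicands are squares of rational functions, so the
  two roots open one after the other.\<close>

lemma A_coeff_third_abs:
  assumes "1 \<le> u"
  shows "A_coeff (third_abs u) = (u ^ 4 - 1) / (u ^ 4 + 1)"
proof -
  define y where "y = 1 / (third_abs u)\<^sup>2"
  have p: "0 < u ^ 4 + 1" by (simp add: add_nonneg_pos)
  have "y = u\<^sup>2 * (u\<^sup>2 + 1)\<^sup>2 / (u ^ 4 + 1)\<^sup>2"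
    by (simp add: y_def third_abs_def power_divide power_mult_distrib)
  then have y: "y * (u ^ 4 + 1)\<^sup>2 = u\<^sup>2 * (u\<^sup>2 + 1)\<^sup>2"
    using p by simp
  have "(1 + 8 * y) * (u ^ 4 + 1)\<^sup>2 = (u ^ 4 + 4 * u\<^sup>2 + 1)\<^sup>2"
    using y by algebra
  then have "1 + 8 * y = ((u ^ 4 + 4 * u\<^sup>2 + 1) / (u ^ 4 + 1))\<^sup>2"
    using p by (simp add: power_divide eq_divide_eq)
  moreover have "0 \<le> (u ^ 4 + 4 * u\<^sup>2 + 1) / (u ^ 4 + 1)"
    by (intro divide_nonneg_nonneg add_nonneg_nonneg) auto
  ultimately have r: "sqrt (1 + 8 * y) = (u ^ 4 + 4 * u\<^sup>2 + 1) / (u ^ 4 + 1)"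
    by simp
  have "1 / 2 * sqrt (1 + 8 * y) + 1 / 2 - 2 * y = ((u ^ 4 - 1) / (u ^ 4 + 1))\<^sup>2"
  proof -
    have "sqrt (1 + 8 * y) * (u ^ 4 + 1) = u ^ 4 + 4 * u\<^sup>2 + 1"
      using r p by simp
    with y have "(1 / 2 * sqrt (1 + 8 * y) + 1 / 2 - 2 * y) * (u ^ 4 + 1)\<^sup>2 = (u ^ 4 - 1)\<^sup>2"
      by algebra
    then show ?thesis using p by (simp add: power_divide eq_divide_eq)
  qed
  moreover have "0 \<le> (u ^ 4 - 1) / (u ^ 4 + 1)"
    using assms p by (simp add: one_le_power)
  moreover have "A_coeff (third_abs u) = sqrt (1 / 2 * sqrt (1 + 8 * y) + 1 / 2 - 2 * y)"
    by (simp add: A_coeff_def y_def)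
  ultimately show ?thesis by (simp only: real_sqrt_abs abs_of_nonneg)
qed

lemma third_abs_mult_A:
  assumes "1 \<le> u"
  shows "third_abs u * A_coeff (third_abs u) = u - 1 / u"
proof -
  have p: "0 < u ^ 4 + 1" "0 < u\<^sup>2 + 1" "0 < u" using assms by (auto simp: add_nonneg_pos)
  have "third_abs u * A_coeff (third_abs u) = (u ^ 4 - 1) / (u * (u\<^sup>2 + 1))"
    unfolding A_coeff_third_abs[OF assms] using p by (simp add: third_abs_def)
  also have "u ^ 4 - 1 = (u\<^sup>2 - 1) * (u\<^sup>2 + 1)" by algebra
  also have "(u\<^sup>2 - 1) * (u\<^sup>2 + 1) / (u * (u\<^sup>2 + 1)) = u - 1 / u"
    using p by (simp add: power2_eq_square diff_divide_distrib)
  finally show ?thesis .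
qed

lemma A_coeff_1 [simp]: "A_coeff 1 = 0"
  using A_coeff_third_abs[of 1] by simp

lemma A_coeff_nonneg:
  assumes "1 \<le> b"
  shows "0 \<le> A_coeff b"
proof -
  obtain u where "1 \<le> u" "b = third_abs u" using assms by (rule third_abs_surj)
  then show ?thesis by (simp add: A_coeff_third_abs)
qed

lemma A_coeff_less_1:
  assumes "1 \<le> b"
  shows "A_coeff b < 1"
proof -
  obtain u where "1 \<le> u" "b = third_abs u" using assms by (rule third_abs_surj)
  moreover have "0 < u ^ 4 + 1" by (simp add: add_nonneg_pos)
  ultimately show ?thesis by (simp add: A_coeff_third_abs)
qed

lemma A_coeff_strict_mono:
  assumes "1 \<le> b" "b < c"
  shows "A_coeff b < A_coeff c"
proof -
  obtain u where u: "1 \<le> u" "b = third_abs u" using assms(1) by (rule third_abs_surj)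
  have "1 \<le> c" using assms by simp
  then obtain v where v: "1 \<le> v" "c = third_abs v" by (rule third_abs_surj)
  have "u < v"
  proof (rule ccontr)
    assume "\<not> u < v"
    then have "c \<le> b" using u v third_abs_mono[of v u] by simp
    then show False using assms by simp
  qed
  then have "u ^ 4 < v ^ 4" using u by (intro power_strict_mono) auto
  moreover have "(p - 1) / (p + 1) < (q - 1) / (q + 1)" if "0 \<le> p" "p < q" for p q :: real
    using that by (simp add: field_simps)
  ultimately show ?thesis using u v by (simp add: A_coeff_third_abs)
qed

lemma A_coeff_tendsto: "(A_coeff \<longlongrightarrow> 1) at_top"
proof -
  have "filterlim (\<lambda>b::real. b\<^sup>2) at_infinity at_top"
    by (intro filterlim_at_top_imp_at_infinity filterlim_pow_at_top filterlim_ident) simp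
  then have *: "((\<lambda>b. c / b\<^sup>2) \<longlongrightarrow> 0) at_top" for c :: real
    by (intro tendsto_divide_0[OF tendsto_const])
  have "(A_coeff \<longlongrightarrow> sqrt (1 / 2 * sqrt (1 + 0) + 1 / 2 - 0)) at_top"
    unfolding A_coeff_def by (intro tendsto_intros *)
  then show ?thesis by simp
qed

text \<open>The tangent to \<open>b A b\<close> at \<open>b = third_abs u\<close>. Its coefficients
  are those of \<open>cubic_majorant\<close> after integration against mean 0 and variance 1: the
  constant \<open>8 * u ^ 3\<close> is \<open>12 * u ^ 3 - 4 * u ^ 3\<close>. In the parameter
  \<open>v\<close> of \<open>x\<close> tangency shows as the factor
  \<open>(v - u)\<^sup>2\<close>.\<close>

lemma A_coeff_tangent:
  assumes "1 \<le> u" "1 \<le> x"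
  shows "(u\<^sup>2 - 1) * (u ^ 4 + 4 * u\<^sup>2 + 1) * (x * A_coeff x) \<le> (u\<^sup>2 + 1) ^ 3 * x - 8 * u ^ 3"
proof -
  obtain v where v: "1 \<le> v" "x = third_abs v" using assms(2) by (rule third_abs_surj)
  have p: "0 < v * (v\<^sup>2 + 1)" using v by (auto simp: add_nonneg_pos)
  have eq: "x * A_coeff x = (v ^ 4 - 1) / (v * (v\<^sup>2 + 1))"
  proof -
    have "0 < v ^ 4 + 1" by (simp add: add_nonneg_pos)
    then show ?thesis using v by (simp add: A_coeff_third_abs) (simp add: third_abs_def)
  qed
  have "0 \<le> 2 * ((v - u)\<^sup>2 * ((3 * u\<^sup>2 + 1) * v\<^sup>2 + (2 * u ^ 3 + 2 * u) * v + (u ^ 4 + 3 * u\<^sup>2)))"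
    using assms v by (intro mult_nonneg_nonneg add_nonneg_nonneg) auto
  also have "\<dots> = (u\<^sup>2 + 1) ^ 3 * (v ^ 4 + 1) - 8 * u ^ 3 * (v * (v\<^sup>2 + 1))
      - (u\<^sup>2 - 1) * (u ^ 4 + 4 * u\<^sup>2 + 1) * (v ^ 4 - 1)"
    by algebra
  finally have le: "(u\<^sup>2 - 1) * (u ^ 4 + 4 * u\<^sup>2 + 1) * (v ^ 4 - 1)
      \<le> (u\<^sup>2 + 1) ^ 3 * (v ^ 4 + 1) - 8 * u ^ 3 * (v * (v\<^sup>2 + 1))"
    by simp
  have "k * (l / d) \<le> w * (m / d) - c" if "k * l \<le> w * m - c * d" "0 < d" for k l d w m c :: real
    using that by (simp add: field_simps)
  from this[OF le p] show ?thesis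
    unfolding eq by (simp add: v(2) third_abs_def)
qed

lemma A_coeff_tangent_eq:
  assumes "1 \<le> u"
  shows "(u\<^sup>2 - 1) * (u ^ 4 + 4 * u\<^sup>2 + 1) * (u - 1 / u) = (u\<^sup>2 + 1) ^ 3 * third_abs u - 8 * u ^ 3"
proof -
  have "0 < u\<^sup>2 + 1" "0 < u" using assms by (auto simp: add_nonneg_pos)
  then show ?thesis unfolding third_abs_def by (simp add: divide_simps) algebra
qed

lemma
  shows concave_on_mult_A_coeff: "concave_on {1..} (\<lambda>b. b * A_coeff b)"
    and concave_on_A_coeff: "concave_on {1..} A_coeff"
proof -
  have *: "p * (x * A_coeff x) + q * (y * A_coeff y) \<le> (p * x + q * y) * A_coeff (p * x + q * y)
      \<and> p * A_coeff x + q * A_coeff y \<le> A_coeff (p * x + q * y)"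
    if h: "1 \<le> x" "1 \<le> y" "0 \<le> p" "0 \<le> q" "p + q = 1" for p q x y
  proof -
    define z where "z = p * x + q * y"
    have z1: "1 \<le> z"
      using mult_left_mono[OF h(1,3)] mult_left_mono[OF h(2,4)] h(5) by (simp add: z_def)
    show ?thesis
    \<comment> \<open>At \<open>z = 1\<close> the parameter is \<open>u = 1\<close>, so
      \<open>K\<close> vanishes and the tangent says nothing about \<open>A_coeff\<close>. But then
      every point of positive weight is itself 1, where \<open>A_coeff\<close> is 0.\<close>
    proof (cases "z = 1")
      case True
      then have "p * (x - 1) + q * (y - 1) = 0" using h by (simp add: z_def algebra_simps)
      then have "p * (x - 1) = 0" "q * (y - 1) = 0"
        using h by (simp_all add: add_nonneg_eq_0_iff)
      then have "p * A_coeff x = 0" "q * A_coeff y = 0" by auto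
      moreover have "p * (x * A_coeff x) = 0" "q * (y * A_coeff y) = 0" using calculation by auto
      ultimately show ?thesis
        unfolding z_def[symmetric] True A_coeff_1 by linarith
    next
      case False
      obtain u where u: "1 \<le> u" "z = third_abs u" using z1 by (rule third_abs_surj)
      then have "1 < u" using False by (cases "u = 1") auto
      define K W c where "K = (u\<^sup>2 - 1) * (u ^ 4 + 4 * u\<^sup>2 + 1)" "W = (u\<^sup>2 + 1) ^ 3" "c = 8 * u ^ 3"
      have K: "0 < K" using \<open>1 < u\<close> by (simp add: K_W_c_def add_nonneg_pos)
      have c: "0 \<le> c" using u by (simp add: K_W_c_def)
      have T: "K * (x * A_coeff x) \<le> W * x - c" if "1 \<le> x" for x
        using A_coeff_tangent[OF u(1) that] by (simp add: K_W_c_def)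
      have E: "K * (z * A_coeff z) = W * z - c"
        using A_coeff_tangent_eq[OF u(1)] third_abs_mult_A[OF u(1)] by (simp add: K_W_c_def u(2))
      have "p * (K * (x * A_coeff x)) + q * (K * (y * A_coeff y)) \<le> p * (W * x - c) + q * (W * y - c)"
        using h by (intro add_mono mult_left_mono T) auto
      also have "\<dots> = W * z - (p + q) * c" by (simp add: z_def algebra_simps)
      also have "\<dots> = K * (z * A_coeff z)" using E h by simp
      finally have "K * (p * (x * A_coeff x) + q * (y * A_coeff y)) \<le> K * (z * A_coeff z)"
        by (simp add: algebra_simps)
      then have 1: "p * (x * A_coeff x) + q * (y * A_coeff y) \<le> z * A_coeff z"
        using K by simp
      have T': "K * A_coeff x \<le> W - c * inverse x" if "1 \<le> x" for x
        using T[OF that] that by (simp add: field_simps)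
      have E': "K * A_coeff z = W - c * inverse z"
        using E z1 by (simp add: field_simps)
      have "inverse z \<le> p * inverse x + q * inverse y"
        using convex_on_inverse[of "{0<..}"] h unfolding convex_on_def z_def by force
      then have inv: "c * inverse z \<le> c * (p * inverse x + q * inverse y)"
        using c by (intro mult_left_mono)
      have "p * (K * A_coeff x) + q * (K * A_coeff y) \<le> p * (W - c * inverse x) + q * (W - c * inverse y)"
        using h by (intro add_mono mult_left_mono T') auto
      also have "\<dots> = (p + q) * W - c * (p * inverse x + q * inverse y)" by (simp add: algebra_simps)
      also have "\<dots> \<le> K * A_coeff z" using E' h inv by simp
      finally have "K * (p * A_coeff x + q * A_coeff y) \<le> K * A_coeff z"
        by (simp add: algebra_simps)
      then have 2: "p * A_coeff x + q * A_coeff y \<le> A_coeff z"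
        using K by simp
      from 1 2 show ?thesis by (simp add: z_def)
    qed
  qed
  show "concave_on {1..} (\<lambda>b. b * A_coeff b)" "concave_on {1..} A_coeff"
    unfolding concave_on_iff using * by (auto simp: algebra_simps)
qed

text \<open>On each half-line the difference of the sides is a cubic. Touching without crossing
  makes the atom there a double root, \<open>u\<close> on the right and \<open>- 1 / u\<close> on
  the left, and the remaining linear factor is nonnegative. The four tangency conditions dictate all
  coefficients up to a common factor.\<close>

lemma cubic_majorant:
  assumes "1 \<le> (u::real)"
  shows "(u\<^sup>2 - 1) * (u ^ 4 + 4 * u\<^sup>2 + 1) * x ^ 3
    \<le> (u\<^sup>2 + 1) ^ 3 * \<bar>x\<bar> ^ 3 - 12 * u ^ 3 * x\<^sup>2 + 6 * u\<^sup>2 * (u\<^sup>2 - 1) * x + 4 * u ^ 3"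
proof (cases "0 \<le> x")
  case True
  have "0 \<le> 2 * ((x - u)\<^sup>2 * ((3 * u\<^sup>2 + 1) * x + 2 * u))"
    using assms True by (intro mult_nonneg_nonneg add_nonneg_nonneg) auto
  also have "\<dots> = (u\<^sup>2 + 1) ^ 3 * x ^ 3 - 12 * u ^ 3 * x\<^sup>2 + 6 * u\<^sup>2 * (u\<^sup>2 - 1) * x + 4 * u ^ 3
      - (u\<^sup>2 - 1) * (u ^ 4 + 4 * u\<^sup>2 + 1) * x ^ 3"
    by algebra
  finally show ?thesis using True by simp
next
  case False
  have "0 \<le> 2 * ((u * x + 1)\<^sup>2 * (u\<^sup>2 * (u\<^sup>2 + 3) * (- x) + 2 * u * u\<^sup>2))"
    using assms False by (intro mult_nonneg_nonneg add_nonneg_nonneg) auto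
  also have "\<dots> = (u\<^sup>2 + 1) ^ 3 * (- x) ^ 3 - 12 * u ^ 3 * x\<^sup>2 + 6 * u\<^sup>2 * (u\<^sup>2 - 1) * x + 4 * u ^ 3
      - (u\<^sup>2 - 1) * (u ^ 4 + 4 * u\<^sup>2 + 1) * x ^ 3"
    by algebra
  finally show ?thesis using False by simp
qed

lemma (in prob_space) abs_third_moment_le:
  fixes X :: "'a \<Rightarrow> real"
  assumes [measurable]: "X \<in> borel_measurable M"
    and int: "integrable M (\<lambda>\<omega>. X \<omega>)" "integrable M (\<lambda>\<omega>. (X \<omega>)\<^sup>2)" "integrable M (\<lambda>\<omega>. \<bar>X \<omega>\<bar> ^ 3)"
    and mom: "(\<integral>\<omega>. X \<omega> \<partial>M) = 0" "(\<integral>\<omega>. (X \<omega>)\<^sup>2 \<partial>M) = 1" "(\<integral>\<omega>. \<bar>X \<omega>\<bar> ^ 3 \<partial>M) = b"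
    and b: "1 \<le> b"
  shows "\<bar>\<integral>\<omega>. X \<omega> ^ 3 \<partial>M\<bar> \<le> b * A_coeff b"
proof -
  have int3: "integrable M (\<lambda>\<omega>. X \<omega> ^ 3)"
    by (rule Bochner_Integration.integrable_bound[OF int(3)]) (auto simp: power_abs)
  obtain v where v: "1 \<le> v" "b = third_abs v" using b by (rule third_abs_surj)
  \<comment> \<open>The majorant is applied to \<open>s * X\<close>: the sign changes neither the
    even terms nor the vanishing mean, so both signs of the third moment are covered.\<close>
  have main: "s * (\<integral>\<omega>. X \<omega> ^ 3 \<partial>M) \<le> v - 1 / v" if s: "s \<in> {1, -1}" for s
  proof (rule field_le_epsilon)
    fix e :: real assume e: "0 < e"
    \<comment> \<open>The shift keeps \<open>u > 1\<close>, so that \<open>K\<close> can be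
      cancelled even when \<open>b = 1\<close>. It raises \<open>u - 1 / u\<close> by at most twice
      \<open>e / 2\<close>.\<close>
    define u where "u = v + e / 2"
    have u: "1 < u" "v \<le> u" using v e by (auto simp: u_def)
    define K W where "K = (u\<^sup>2 - 1) * (u ^ 4 + 4 * u\<^sup>2 + 1)" "W = (u\<^sup>2 + 1) ^ 3"
    have K: "0 < K" using u by (simp add: K_W_def add_nonneg_pos)
    have "(\<integral>\<omega>. K * (s * X \<omega> ^ 3) \<partial>M)
        \<le> (\<integral>\<omega>. W * \<bar>X \<omega>\<bar> ^ 3 - 12 * u ^ 3 * (X \<omega>)\<^sup>2 + 6 * u\<^sup>2 * (u\<^sup>2 - 1) * s * X \<omega> + 4 * u ^ 3 \<partial>M)"
      using int int3 s cubic_majorant[of u "s * X _"] u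
      by (intro integral_mono) (auto simp: K_W_def)
    also have "\<dots> = W * b - 8 * u ^ 3"
      using int by (simp add: mom prob_space)
    also have "\<dots> \<le> W * third_abs u - 8 * u ^ 3"
      using third_abs_mono[of v u] u v by (auto simp: K_W_def intro!: mult_left_mono)
    also have "\<dots> = K * (u - 1 / u)"
      using A_coeff_tangent_eq[of u] u by (simp add: K_W_def)
    finally have "s * (\<integral>\<omega>. X \<omega> ^ 3 \<partial>M) \<le> u - 1 / u" using K by simp
    moreover have "1 / v - 1 / u \<le> u - v"
    proof -
      have "1 / v - 1 / u = (u - v) / (u * v)" using u v by (simp add: field_simps)
      also have "\<dots> \<le> (u - v) / 1"
        using mult_mono[of 1 u 1 v] u v by (intro divide_left_mono) auto
      finally show ?thesis by simp
    qed
    moreover have "u - v = e / 2" by (simp add: u_def)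
    ultimately show "s * (\<integral>\<omega>. X \<omega> ^ 3 \<partial>M) \<le> v - 1 / v + e" by linarith
  qed
  show ?thesis
    using main[of 1] main[of "-1"] third_abs_mult_A[OF v(1)] v(2) by (simp add: abs_le_iff)
qed

subsection \<open>The coefficients gamma\<close>

lemma gamma_coeff_attained:
  assumes "n \<ge> 1"
  obtains l where "l \<in> {lambda_lower n..lambda_upper n}"
    "gamma_coeff n b = l * A_coeff b + taylor_q n l"
    "\<And>m. m \<in> {lambda_lower n..lambda_upper n} \<Longrightarrow> gamma_coeff n b \<le> m * A_coeff b + taylor_q n m"
proof -
  let ?I = "{lambda_lower n..lambda_upper n}"
  have "continuous_on ?I (\<lambda>l. l * A_coeff b + taylor_q n l)"
    by (intro continuous_intros continuous_on_taylor_q)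
  moreover have "?I \<noteq> {}" using lambda_lower_props(3)[OF assms] by simp
  ultimately obtain l where l: "l \<in> ?I"
    "\<And>m. m \<in> ?I \<Longrightarrow> l * A_coeff b + taylor_q n l \<le> m * A_coeff b + taylor_q n m"
    using continuous_attains_inf[of ?I "\<lambda>l. l * A_coeff b + taylor_q n l"] by blast
  then have "gamma_coeff n b = l * A_coeff b + taylor_q n l"
    unfolding gamma_coeff_def
    by (intro antisym cINF_lower cINF_greatest bdd_belowI2) auto
  with l show ?thesis using that by simp
qed

lemma gamma_coeff_le:
  assumes "n \<ge> 1" "l \<in> {lambda_lower n..lambda_upper n}"
  shows "gamma_coeff n b \<le> l * A_coeff b + taylor_q n l"
  using gamma_coeff_attained[OF assms(1), of b] assms(2) by metis

text \<open>\<open>A_coeff 1\<close> is 0, so only \<open>taylor_q\<close> is minimised, and the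
  right endpoint is a minimiser on the whole half-line.\<close>

lemma gamma_coeff_1:
  assumes "n \<ge> 1"
  shows "gamma_coeff n 1 = taylor_q n (lambda_upper n)"
proof -
  obtain l where "l \<in> {lambda_lower n..lambda_upper n}" "gamma_coeff n 1 = taylor_q n l"
    using gamma_coeff_attained[OF assms, of 1] by auto
  moreover have "taylor_q n (lambda_upper n) \<le> taylor_q n l"
    using calculation lambda_lower_props(1)[OF assms] by (intro lambda_upper_props(2)) auto
  moreover have "gamma_coeff n 1 \<le> taylor_q n (lambda_upper n)"
    using gamma_coeff_le[OF assms, of "lambda_upper n" 1] lambda_lower_props(3)[OF assms] by simp
  ultimately show ?thesis by simp
qed

text \<open>The minimiser for the larger argument competes at the smaller one; it is at least
  \<open>lambda_lower n > 0\<close>, which makes the gain strict.\<close>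

lemma gamma_coeff_strict_mono:
  assumes "n \<ge> 1" "1 \<le> b" "b < c"
  shows "gamma_coeff n b < gamma_coeff n c"
proof -
  obtain l where l: "l \<in> {lambda_lower n..lambda_upper n}"
      "gamma_coeff n c = l * A_coeff c + taylor_q n l"
    using gamma_coeff_attained[OF assms(1), of c] by metis
  have "0 < l" using l lambda_lower_props(1)[OF assms(1)] by auto
  then have "l * A_coeff b < l * A_coeff c" using A_coeff_strict_mono[OF assms(2,3)] by simp
  then show ?thesis using l gamma_coeff_le[OF assms(1) l(1), of b] by simp
qed

lemma gamma_coeff_nonneg:
  assumes "n \<ge> 1" "1 \<le> b"
  shows "0 \<le> gamma_coeff n b"
proof -
  obtain l where l: "l \<in> {lambda_lower n..lambda_upper n}"
      "gamma_coeff n b = l * A_coeff b + taylor_q n l"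
    using gamma_coeff_attained[OF assms(1), of b] by metis
  then show ?thesis
    using lambda_lower_props(1)[OF assms(1)] A_coeff_nonneg[OF assms(2)] taylor_q_nonneg[of n l]
    by simp
qed

lemma mult_gamma_coeff_strict_mono:
  assumes "n \<ge> 1" "1 \<le> b" "b < c"
  shows "b * gamma_coeff n b < c * gamma_coeff n c"
  using gamma_coeff_strict_mono[OF assms] gamma_coeff_nonneg[OF assms(1,2)] assms(2,3)
  by (intro mult_strict_mono) auto

text \<open>Test the minimum at the left endpoint, where \<open>taylor_q\<close> equals
  \<open>1 - l\<close> and the value is \<open>1 - l * (1 - A_coeff b)\<close>.\<close>

lemma gamma_coeff_less_1:
  assumes "n \<ge> 1" "1 \<le> b"
  shows "gamma_coeff n b < 1"
proof -
  note L = lambda_lower_props[OF assms(1)]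
  have "lambda_lower n * A_coeff b < lambda_lower n"
    using L(1) A_coeff_less_1[OF assms(2)] by simp
  moreover have "gamma_coeff n b \<le> lambda_lower n * A_coeff b + taylor_q n (lambda_lower n)"
    using L by (intro gamma_coeff_le assms) auto
  ultimately show ?thesis using L(2) by linarith
qed

text \<open>\<open>taylor_q_ge\<close> bounds each competitor below by
  \<open>1 - l * (1 - A_coeff b)\<close>, uniformly since \<open>l\<close> is at most
  \<open>lambda_upper n\<close>.\<close>

lemma gamma_coeff_tendsto:
  assumes "n \<ge> 1"
  shows "(gamma_coeff n \<longlongrightarrow> 1) at_top"
proof (rule tendsto_sandwich)
  let ?U = "lambda_upper n"
  show "\<forall>\<^sub>F b in at_top. 1 - ?U * (1 - A_coeff b) \<le> gamma_coeff n b"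
    using eventually_ge_at_top[of 1]
  proof eventually_elim
    case (elim b)
    obtain l where l: "l \<in> {lambda_lower n..?U}" "gamma_coeff n b = l * A_coeff b + taylor_q n l"
      using gamma_coeff_attained[OF assms, of b] by metis
    have "l * (1 - A_coeff b) \<le> ?U * (1 - A_coeff b)"
      using l A_coeff_less_1[OF elim] by (intro mult_right_mono) auto
    then show ?case using l(2) taylor_q_ge[of l n] by (simp add: algebra_simps)
  qed
  show "\<forall>\<^sub>F b in at_top. gamma_coeff n b \<le> 1"
    using eventually_ge_at_top[of 1]
    by eventually_elim (use gamma_coeff_less_1[OF assms] in \<open>auto intro: less_imp_le\<close>)
  have "((\<lambda>b. 1 - ?U * (1 - A_coeff b)) \<longlongrightarrow> 1 - ?U * (1 - 1)) at_top"
    by (intro tendsto_intros A_coeff_tendsto)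
  then show "((\<lambda>b. 1 - ?U * (1 - A_coeff b)) \<longlongrightarrow> 1) at_top" by simp
qed simp

text \<open>For fixed \<open>l \<ge> 0\<close> the competitor, and also \<open>b\<close> times it,
  is concave in \<open>b\<close>; the minimiser at the mixed point is used as competitor at both
  ends.\<close>

lemma concave_on_gamma_coeff:
  assumes "n \<ge> 1"
  shows "concave_on {1..} (gamma_coeff n)" and "concave_on {1..} (\<lambda>b. b * gamma_coeff n b)"
proof -
  have *: "p * gamma_coeff n x + q * gamma_coeff n y \<le> gamma_coeff n (p * x + q * y)
      \<and> p * (x * gamma_coeff n x) + q * (y * gamma_coeff n y) \<le> (p * x + q * y) * gamma_coeff n (p * x + q * y)"
    if h: "1 \<le> x" "1 \<le> y" "0 \<le> p" "0 \<le> q" "p + q = 1" for p q x y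
  proof -
    define z where "z = p * x + q * y"
    obtain l where l: "l \<in> {lambda_lower n..lambda_upper n}"
        "gamma_coeff n z = l * A_coeff z + taylor_q n l"
      using gamma_coeff_attained[OF assms(1), of z] by metis
    have l0: "0 \<le> l" using l lambda_lower_props(1)[OF assms(1)] by auto
    note le = gamma_coeff_le[OF assms l(1)]
    have "p * A_coeff x + q * A_coeff y \<le> A_coeff z"
      using concave_on_A_coeff h unfolding concave_on_iff z_def by auto
    then have A: "l * (p * A_coeff x + q * A_coeff y) \<le> l * A_coeff z"
      using l0 by (rule mult_left_mono)
    have "p * gamma_coeff n x + q * gamma_coeff n y
        \<le> p * (l * A_coeff x + taylor_q n l) + q * (l * A_coeff y + taylor_q n l)"
      using h le by (intro add_mono mult_left_mono) auto
    also have "\<dots> = l * (p * A_coeff x + q * A_coeff y) + (p + q) * taylor_q n l"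
      by (simp add: algebra_simps)
    also have "\<dots> \<le> gamma_coeff n z" using A l h by simp
    finally have 1: "p * gamma_coeff n x + q * gamma_coeff n y \<le> gamma_coeff n z" .
    have "p * (x * A_coeff x) + q * (y * A_coeff y) \<le> z * A_coeff z"
      using concave_on_mult_A_coeff h unfolding concave_on_iff z_def by auto
    then have A: "l * (p * (x * A_coeff x) + q * (y * A_coeff y)) \<le> l * (z * A_coeff z)"
      using l0 by (rule mult_left_mono)
    have "p * (x * gamma_coeff n x) + q * (y * gamma_coeff n y)
        \<le> p * (x * (l * A_coeff x + taylor_q n l)) + q * (y * (l * A_coeff y + taylor_q n l))"
      using h le by (intro add_mono mult_left_mono) auto
    also have "\<dots> = l * (p * (x * A_coeff x) + q * (y * A_coeff y)) + z * taylor_q n l"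
      by (simp add: algebra_simps z_def)
    also have "\<dots> \<le> z * gamma_coeff n z" using A l by (simp add: algebra_simps)
    finally show ?thesis using 1 by (simp add: z_def)
  qed
  show "concave_on {1..} (gamma_coeff n)" "concave_on {1..} (\<lambda>b. b * gamma_coeff n b)"
    unfolding concave_on_iff using * by auto
qed

subsection \<open>The constant theta\<close>

text \<open>The property "once nonnegative, positive ever after" passes from a derivative to its
  integral from 0: if \<open>f x \<ge> f 0\<close>, the derivative was nonnegative somewhere before
  \<open>x\<close> and hence is positive after it. It is applied repeatedly in
  \<open>taylor_ratio_1_disc\<close>.\<close>

lemma single_crossing_integral:
  fixes f :: "real \<Rightarrow> real"
  assumes "f 0 = 0" and der: "\<And>x. (f has_real_derivative f' x) (at x)"
    and cross: "\<And>x y. 0 < x \<Longrightarrow> x < y \<Longrightarrow> y < p \<Longrightarrow> 0 \<le> f' x \<Longrightarrow> 0 < f' y"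
    and "0 < x" "x < y" "y < p" "0 \<le> f x"
  shows "0 < f y"
proof -
  obtain z where z: "0 < z" "z < x" "f x - f 0 = (x - 0) * f' z"
    using MVT2[OF \<open>0 < x\<close> der] by blast
  then have "0 \<le> f' z" using assms by (simp add: zero_le_mult_iff)
  obtain w where w: "x < w" "w < y" "f y - f x = (y - x) * f' w"
    using MVT2[OF \<open>x < y\<close> der] by blast
  have "0 < f' w" using cross[of z w] \<open>0 \<le> f' z\<close> z w assms by simp
  then have "0 < (y - x) * f' w" using assms by simp
  then show ?thesis using w assms by simp
qed

text \<open>The derivative \<open>x * cos x\<close> makes the function rise from 0 on
  \<open>[0, pi / 2]\<close> and fall to a negative value at \<open>pi\<close>. Hence the root is
  unique, which justifies the \<open>THE\<close> in \<open>theta1\<close>.\<close>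

lemma theta1_sign:
  shows "pi / 2 < theta1" "theta1 < pi" "theta1 * sin theta1 + cos theta1 - 1 = 0"
    and "0 < x \<Longrightarrow> x < theta1 \<Longrightarrow> 0 < x * sin x + cos x - 1"
    and "theta1 < x \<Longrightarrow> x \<le> pi \<Longrightarrow> x * sin x + cos x - 1 < 0"
proof -
  define h where "h = (\<lambda>x::real. x * sin x + cos x - 1)"
  have der: "(h has_real_derivative x * cos x) (at x)" for x
    unfolding h_def by (auto intro!: derivative_eq_intros)
  have cont: "continuous_on S h" for S unfolding h_def by (intro continuous_intros)
  have inc: "0 < h x" if "0 < x" "x \<le> pi / 2" for x
  proof -
    have "h 0 < h x"
    proof (rule DERIV_pos_imp_increasing_open[OF \<open>0 < x\<close> _ cont])
      fix y assume "0 < y" "y < x"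
      then have "0 < y * cos y" using that by (intro mult_pos_pos cos_gt_zero) auto
      then show "\<exists>d. (h has_real_derivative d) (at y) \<and> 0 < d" using der by blast
    qed
    then show ?thesis by (simp add: h_def)
  qed
  have dec: "h y < h x" if "pi / 2 \<le> x" "x < y" "y \<le> pi" for x y
  proof (rule DERIV_neg_imp_decreasing_open[OF \<open>x < y\<close> _ cont])
    fix w assume w: "x < w" "w < y"
    then have "cos w < cos (pi / 2)" using that by (intro cos_monotone_0_pi) auto
    then have "w * cos w < 0" using w that pi_gt_zero by (intro mult_pos_neg) auto
    then show "\<exists>d. (h has_real_derivative d) (at w) \<and> d < 0" using der by blast
  qed
  obtain t where t: "pi / 2 \<le> t" "t \<le> pi" "h t = 0"
  proof -
    have "h pi \<le> 0" "0 \<le> h (pi / 2)" using inc[of "pi / 2"] by (simp_all add: h_def)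
    then show ?thesis using IVT2'[of h pi 0 "pi / 2"] cont that by auto
  qed
  have "0 < h (pi / 2)" "h pi < 0" using inc[of "pi / 2"] by (simp_all add: h_def)
  then have "t \<noteq> pi / 2" "t \<noteq> pi" using t(3) by (metis less_irrefl)+
  then have t': "pi / 2 < t" "t < pi" using t by auto
  have pos: "0 < h x" if "0 < x" "x < t" for x
    using inc[of x] dec[of x t] that t by (cases "x \<le> pi / 2") auto
  have neg: "h x < 0" if "t < x" "x \<le> pi" for x
    using dec[of t x] that t by auto
  have "theta1 = t"
    unfolding theta1_def
  proof (rule the_equality)
    show "0 < t \<and> t < pi \<and> t * sin t + cos t - 1 = 0"
      using t t' pi_gt_zero by (auto simp: h_def intro: less_trans[of 0 "pi / 2"])
    fix x assume "0 < x \<and> x < pi \<and> x * sin x + cos x - 1 = 0"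
    then show "x = t" using pos[of x] neg[of x] by (cases x t rule: linorder_cases) (auto simp: h_def)
  qed
  then show "pi / 2 < theta1" "theta1 < pi" "theta1 * sin theta1 + cos theta1 - 1 = 0"
    "0 < x \<Longrightarrow> x < theta1 \<Longrightarrow> 0 < x * sin x + cos x - 1"
    "theta1 < x \<Longrightarrow> x \<le> pi \<Longrightarrow> x * sin x + cos x - 1 < 0"
    using t t' pos neg by (auto simp: h_def)
qed

section \<open>Numerical bounds for theta1 and its sine\<close>

lemma theta1_less: "theta1 < 5 / 2"
proof -
  have s: "sqrt 2 \<le> 1.42" by (rule real_le_lsqrt) (auto simp: power2_eq_square)
  have "3 * pi / 4 - 1 < 1.37" using pi_approx by simp
  moreover have "0 < 3 * pi / 4 - 1" using pi_gt3 by simp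
  ultimately have "(3 * pi / 4 - 1) * (sqrt 2 / 2) < 1.37 * 0.72"
    using s by (intro mult_strict_mono) auto
  then have "(3 * pi / 4 - 1) * (sqrt 2 / 2) < 1"
    by (rule less_trans) simp
  \<comment> \<open>The test point \<open>3 * pi / 4\<close>, about 2.356, is just above the root
    and has explicit sine and cosine.\<close>
  moreover have "sin (3 * pi / 4) = sqrt 2 / 2" "cos (3 * pi / 4) = - (sqrt 2 / 2)"
    using sin_pi_minus[of "pi / 4"] cos_pi_minus[of "pi / 4"] by (simp_all add: sin_45 cos_45)
  then have "3 * pi / 4 * sin (3 * pi / 4) + cos (3 * pi / 4) - 1 = (3 * pi / 4 - 1) * (sqrt 2 / 2) - 1"
    by (simp only:) (simp add: algebra_simps)
  ultimately have "3 * pi / 4 * sin (3 * pi / 4) + cos (3 * pi / 4) - 1 < 0"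
    by (simp only:)
  then have "theta1 \<le> 3 * pi / 4"
    using theta1_sign(4)[of "3 * pi / 4"] pi_gt_zero by fastforce
  then show ?thesis using pi_approx by simp
qed

lemma sin_le_taylor:
  fixes y :: real
  shows "sin y \<le> (\<Sum>k<n. (- 1) ^ k / fact (2 * k + 1) * y ^ (2 * k + 1)) + y ^ (2 * n) / fact (2 * n)"
proof -
  have "(\<Sum>m<2 * n. sin_coeff m * y ^ m) = (\<Sum>k<n. (- 1) ^ k / fact (2 * k + 1) * y ^ (2 * k + 1))"
    by (induction n) (simp_all add: sin_coeff_def)
  then show ?thesis
    using Maclaurin_sin_bound[of y "2 * n"] by (simp add: divide_inverse mult.commute abs_le_iff power_even_abs)
qed

lemma cos_ge_taylor:
  fixes y :: real
  shows "(\<Sum>k<n. (- 1) ^ k / fact (2 * k) * y ^ (2 * k)) - y ^ (2 * n) / fact (2 * n) \<le> cos y"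
proof -
  obtain t where "cos y = (\<Sum>m<2 * n. cos_coeff m * y ^ m)
      + (cos (t + 1 / 2 * real (2 * n) * pi) / fact (2 * n)) * y ^ (2 * n)"
    using Maclaurin_cos_expansion[of y "2 * n"] by blast
  moreover have "(\<Sum>m<2 * n. cos_coeff m * y ^ m) = (\<Sum>k<n. (- 1) ^ k / fact (2 * k) * y ^ (2 * k))"
    by (induction n) (simp_all add: cos_coeff_def)
  moreover have "(- 1 / fact (2 * n)) * y ^ (2 * n)
      \<le> (cos (t + 1 / 2 * real (2 * n) * pi) / fact (2 * n)) * y ^ (2 * n)"
    by (intro mult_right_mono divide_right_mono) auto
  ultimately show ?thesis by simp
qed

lemma theta1_greater: "2.3308 \<le> theta1"
proof (rule ccontr)
  assume less: "\<not> ?thesis"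
  \<comment> \<open>Half of 2.3308. By the double angle formulas the function at
    \<open>2 * y\<close> is \<open>2 * sin y * (2 * y * cos y - sin y)\<close>, so short expansions
    at the small argument \<open>y\<close> decide its sign.\<close>
  define y :: real where "y = 1.1654"
  have "sin y \<le> (\<Sum>k<5. (- 1) ^ k / fact (2 * k + 1) * y ^ (2 * k + 1)) + y ^ (2 * 5) / fact (2 * 5)"
    by (rule sin_le_taylor)
  also have "\<dots> < 2 * y * ((\<Sum>k<5. (- 1) ^ k / fact (2 * k) * y ^ (2 * k)) - y ^ (2 * 5) / fact (2 * 5))"
    unfolding y_def by (simp add: lessThan_nat_numeral lessThan_Suc fact_numeral power_divide)
  also have "\<dots> \<le> 2 * y * cos y" by (intro mult_left_mono cos_ge_taylor) (auto simp: y_def)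
  finally have "sin y < 2 * y * cos y" .
  moreover have "0 < sin y" using pi_gt3 by (intro sin_gt_zero) (auto simp: y_def)
  ultimately have "0 < 2 * sin y * (2 * y * cos y - sin y)" by simp
  also have "\<dots> = 2 * y * sin (2 * y) + cos (2 * y) - 1"
    by (simp only: sin_double cos_double_sin) (simp add: power2_eq_square algebra_simps)
  finally have "0 < 2.3308 * sin 2.3308 + cos 2.3308 - (1::real)" by (simp add: y_def)
  then show False
    using theta1_sign(5)[of "2.3308"] less pi_gt3 by simp
qed

text \<open>Eliminating the cosine from the defining equation by
  \<open>sin\<^sup>2 + cos\<^sup>2 = 1\<close> leaves a quadratic in the sine with one nonzero root.
  Numerical bounds for \<open>theta1\<close> thereby turn into rational ones for its sine.\<close>

lemma sin_theta1: "sin theta1 = 2 * theta1 / (1 + theta1\<^sup>2)"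
  and cos_theta1: "1 - cos theta1 = theta1 * sin theta1"
proof -
  show c: "1 - cos theta1 = theta1 * sin theta1" using theta1_sign(3) by simp
  have "1 - theta1 * sin theta1 = cos theta1" using c by simp
  then have "(sin theta1)\<^sup>2 + (1 - theta1 * sin theta1)\<^sup>2 = 1"
    by (simp only: sin_cos_squared_add)
  then have "sin theta1 * (sin theta1 * (1 + theta1\<^sup>2) - 2 * theta1) = 0" by algebra
  moreover have "0 < sin theta1" using theta1_sign pi_gt_zero by (intro sin_gt_zero) auto
  ultimately have "sin theta1 * (1 + theta1\<^sup>2) = 2 * theta1" by simp
  moreover have "0 < 1 + theta1\<^sup>2" by (simp add: add_pos_nonneg)
  ultimately show "sin theta1 = 2 * theta1 / (1 + theta1\<^sup>2)" by (simp add: eq_divide_eq)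
qed

lemma theta1_ratio_eq: "(1 - cos theta1) / theta1 = sin theta1"
  using theta1_greater by (simp add: cos_theta1)

lemma sin_theta1_le: "sin theta1 \<le> 0.7247"
proof -
  \<comment> \<open>A linear lower bound for the square of \<open>theta1\<close>, which reduces the
    claim to a linear inequality.\<close>
  have "0 \<le> (theta1 - 2.3308) * (theta1 - 1)"
    using theta1_greater by (intro mult_nonneg_nonneg) auto
  then have "3.3308 * theta1 - 2.3308 \<le> theta1\<^sup>2"
    by (simp add: field_simps power2_eq_square)
  then have "2 * theta1 \<le> 0.7247 * (1 + theta1\<^sup>2)"
    using theta1_greater by simp
  then show ?thesis
    by (simp add: sin_theta1 divide_le_eq add_pos_nonneg)
qed

text \<open>The inequality says that the curve \<open>taylor_ratio 1\<close> lies in the disc of centre \<open>l\<close> and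
  radius \<open>sin theta1\<close>, which it touches at \<open>theta1\<close>. On \<open>(0, pi)\<close> divide by \<open>x\<^sup>2\<close>: up to the
  factor \<open>x ^ 3\<close>, the derivative of the quotient is \<open>N\<close> below, which changes sign exactly once
  because an iterated derivative visibly does.\<close>

lemma taylor_ratio_1_disc:
  assumes "0 < x"
  defines "l \<equiv> sin theta1 / theta1"
  shows "0 \<le> l * (1 - l) * x\<^sup>2 + l * x * sin x - 1 + cos x"
proof -
  have th: "0 < theta1" "theta1 < pi" using theta1_greater theta1_sign by auto
  have lt: "l * theta1 = sin theta1" using th by (simp add: l_def)
  have l: "l = 2 / (1 + theta1\<^sup>2)" using th by (simp add: l_def sin_theta1)
  have tt: "5 \<le> theta1\<^sup>2" "theta1\<^sup>2 \<le> 7"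
    using power_mono[OF theta1_greater, of 2] power_mono[of theta1 "5/2" 2] theta1_less th
    by (auto simp: power2_eq_square)
  have l_bounds: "1 / 4 \<le> l" "l \<le> 1 / 3"
    using tt unfolding l by (simp_all add: field_simps)
  have l_eq: "l * (1 + theta1\<^sup>2) = 2"
    using nonzero_eq_divide_eq[of "1 + theta1\<^sup>2" l 2] tt l by simp
  \<comment> \<open>Successive derivatives: \<open>N' = g\<close>, \<open>g' = x k\<close>, and
    \<open>k'\<close> is the derivative of \<open>k\<close>. All three functions \<open>N\<close>,
    \<open>g\<close>, \<open>k\<close> vanish at 0. For \<open>k'\<close> the crossing is visible
    because \<open>l \<ge> 1 / 4\<close> makes \<open>1 - 4 * l\<close> nonpositive.\<close>
  define k' where "k' = (\<lambda>x. (1 - 4 * l) * cos x + l * x * sin x)"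
  define k where "k = (\<lambda>x. (1 - 3 * l) * sin x - l * x * cos x)"
  define g where "g = (\<lambda>x. (1 - l) * (sin x - x * cos x) - l * x\<^sup>2 * sin x)"
  define N where "N = (\<lambda>x. l * x\<^sup>2 * cos x - (1 + l) * x * sin x + 2 * (1 - cos x))"
  have cross_k': "0 < k' y" if h: "0 < x" "x < y" "y < pi" "0 \<le> k' x" for x y
  proof -
    have siny: "0 < sin y" using h by (intro sin_gt_zero) auto
    show ?thesis
    proof (cases "y \<le> pi / 2")
      case True
      have "sin x \<le> sin y" using h True by (intro sin_monotone_2pi_le) auto
      then have "x * sin x < y * sin y"
        using h siny by (intro mult_less_le_imp_less) (auto intro: sin_ge_zero sin_gt_zero)
      then have "l * (x * sin x) < l * (y * sin y)" using l_bounds by simp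
      moreover have "cos y \<le> cos x" using h by (intro cos_monotone_0_pi_le) auto
      then have "(1 - 4 * l) * cos x \<le> (1 - 4 * l) * cos y"
        using l_bounds by (intro mult_left_mono_neg) auto
      ultimately show ?thesis using h(4) unfolding k'_def by (simp add: mult.assoc)
    next
      case False
      then have "cos y \<le> cos (pi / 2)" using h by (intro cos_monotone_0_pi_le) auto
      then have "0 \<le> (1 - 4 * l) * cos y"
        using l_bounds by (intro mult_nonpos_nonpos) auto
      moreover have "0 < l * y * sin y" using h siny l_bounds by (intro mult_pos_pos) auto
      ultimately show ?thesis unfolding k'_def by simp
    qed
  qed
  have cross_k: "0 < k y" if h: "0 < x" "x < y" "y < pi" "0 \<le> k x" for x y
  proof (rule single_crossing_integral[of k k' pi x y])
    show "(k has_real_derivative k' x) (at x)" for x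
      unfolding k_def k'_def by (auto intro!: derivative_eq_intros simp: algebra_simps)
  qed (use h cross_k' in \<open>auto simp: k_def\<close>)
  have cross_g: "0 < g y" if h: "0 < x" "x < y" "y < pi" "0 \<le> g x" for x y
  proof (rule single_crossing_integral[of g "\<lambda>x. x * k x" pi x y])
    show "(g has_real_derivative x * k x) (at x)" for x
      unfolding k_def g_def
      by (auto intro!: derivative_eq_intros simp: algebra_simps power2_eq_square)
  qed (use h cross_k in \<open>auto simp: g_def zero_le_mult_iff zero_less_mult_iff\<close>)
  have cross_N: "0 < N y" if h: "0 < x" "x < y" "y < pi" "0 \<le> N x" for x y
  proof (rule single_crossing_integral[of N g pi x y])
    show "(N has_real_derivative g x) (at x)" for x
      unfolding N_def g_def
      by (auto intro!: derivative_eq_intros simp: algebra_simps power2_eq_square)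
  qed (use h cross_g in \<open>auto simp: N_def\<close>)
  have cos: "cos theta1 = 1 - theta1 * sin theta1" using cos_theta1 by simp
  \<comment> \<open>This places the sign change of \<open>N\<close> at \<open>theta1\<close>. The
    quotient of \<open>Q\<close> by \<open>x\<^sup>2\<close> thus falls before and rises after it,
    and its minimum there is 0.\<close>
  have Nth: "N theta1 = 0"
  proof -
    have "N theta1 = l * theta1\<^sup>2 * (2 - l * (1 + theta1\<^sup>2))"
      unfolding N_def cos lt[symmetric] by (simp add: algebra_simps power2_eq_square)
    then show ?thesis by (simp add: l_eq)
  qed
  define Q where "Q = (\<lambda>x. l * (1 - l) * x\<^sup>2 + l * x * sin x - 1 + cos x)"
  have Qth: "Q theta1 = 0"
    unfolding Q_def cos lt[symmetric] by (simp add: algebra_simps power2_eq_square)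
  have derQ: "(Q has_real_derivative (2 * l * (1 - l)) * x - (1 - l) * sin x + l * x * cos x) (at x)" for x
    unfolding Q_def by (auto intro!: derivative_eq_intros simp: algebra_simps power2_eq_square)
  have der: "((\<lambda>x. Q x / x\<^sup>2) has_real_derivative N x / x ^ 3) (at x)" if "0 < x" for x
    using that unfolding N_def
    by (auto intro!: derivative_eq_intros derQ simp: Q_def field_simps eval_nat_numeral)
  have Q_pi: "0 \<le> Q x" if "0 < x" "x \<le> pi" for x
  proof -
    consider "x < theta1" | "x = theta1" | "theta1 < x" by linarith
    then have "0 \<le> Q x / x\<^sup>2"
    proof cases
      case 1
      have "\<exists>z>x. z < theta1 \<and> Q theta1 / theta1\<^sup>2 - Q x / x\<^sup>2 = (theta1 - x) * (N z / z ^ 3)"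
        by (rule MVT2[OF 1]) (use der that in auto)
      then obtain z where z: "x < z" "z < theta1"
        "Q theta1 / theta1\<^sup>2 - Q x / x\<^sup>2 = (theta1 - x) * (N z / z ^ 3)"
        by blast
      have "N z < 0" using cross_N[of z theta1] Nth th z that by fastforce
      then have "(theta1 - x) * (N z / z ^ 3) \<le> 0"
        using z that by (intro mult_nonneg_nonpos divide_nonpos_pos) auto
      then show ?thesis using z(3) Qth by simp
    next
      case 3
      have "\<exists>z>theta1. z < x \<and> Q x / x\<^sup>2 - Q theta1 / theta1\<^sup>2 = (x - theta1) * (N z / z ^ 3)"
        by (rule MVT2[OF 3]) (use der th in auto)
      then obtain z where z: "theta1 < z" "z < x"
        "Q x / x\<^sup>2 - Q theta1 / theta1\<^sup>2 = (x - theta1) * (N z / z ^ 3)"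
        by blast
      have "0 < N z" using cross_N[of theta1 z] Nth th z that by simp
      then have "0 \<le> (x - theta1) * (N z / z ^ 3)"
        using z th by (intro mult_nonneg_nonneg divide_nonneg_pos) auto
      then show ?thesis using z(3) Qth by simp
    qed (simp add: Qth)
    then show ?thesis using that by (simp add: zero_le_divide_iff)
  qed
  \<comment> \<open>On \<open>[pi, 2 * pi]\<close> the sine is nonpositive and
    \<open>2 * (1 - l) \<ge> 1\<close>, so \<open>Q\<close> increases from \<open>Q pi\<close>.
    Beyond \<open>2 * pi\<close> the quadratic term dominates: 18/4 exceeds the 2 that can be
    lost.\<close>
  consider "x \<le> pi" | "pi < x" "x \<le> 2 * pi" | "2 * pi < x" by linarith
  then have "0 \<le> Q x"
  proof cases
    case 1 then show ?thesis using Q_pi assms by simp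
  next
    case 2
    have "Q pi \<le> Q x"
    proof (rule DERIV_nonneg_imp_nondecreasing[where f = Q])
      fix y assume y: "pi \<le> y" "y \<le> x"
      have "sin y \<le> 0"
        using sin_ge_zero[of "y - pi"] y 2 by simp
      then have "(1 - l) * sin y \<le> 0" using l_bounds by (intro mult_nonneg_nonpos) auto
      moreover have ly: "0 \<le> l * y" using l_bounds y pi_gt_zero by (intro mult_nonneg_nonneg) linarith+
      moreover have "l * y * (-1) \<le> l * y * cos y"
        using ly by (intro mult_left_mono) auto
      moreover have "l * y * 1 \<le> l * y * (2 * (1 - l))"
        using ly l_bounds by (intro mult_left_mono) auto
      ultimately have "0 \<le> (2 * l * (1 - l)) * y - (1 - l) * sin y + l * y * cos y"
        by (simp add: algebra_simps)
      then show "\<exists>d. (Q has_real_derivative d) (at y) \<and> 0 \<le> d" using derQ by blast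
    qed (use 2 in simp)
    then show ?thesis using Q_pi[of pi] by simp
  next
    case 3
    have x: "6 \<le> x" using 3 pi_gt3 by simp
    have "1 / 4 * 18 \<le> l * ((1 - l) * x\<^sup>2 - x)"
    proof (intro mult_mono)
      have "18 \<le> (2 / 3 * x - 1) * x"
        using mult_mono[of 3 "2 / 3 * x - 1" 6 x] x by simp
      also have "\<dots> \<le> (1 - l) * x\<^sup>2 - x"
        using mult_right_mono[of "2 / 3" "1 - l" "x\<^sup>2"] l_bounds
        by (simp add: power2_eq_square algebra_simps)
      finally show "18 \<le> (1 - l) * x\<^sup>2 - x" .
    qed (use l_bounds in auto)
    moreover have "l * x * (-1) \<le> l * x * sin x"
      using l_bounds x by (intro mult_left_mono) auto
    moreover have "l * ((1 - l) * x\<^sup>2 - x) = l * (1 - l) * x\<^sup>2 - l * x" by algebra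
    moreover have "-1 \<le> cos x" by simp
    ultimately show ?thesis unfolding Q_def by linarith
  qed
  then show ?thesis by (simp add: Q_def)
qed

text \<open>The ratio for \<open>n = 1\<close> is \<open>sin x / x + \<i> (1 - cos x) / x\<close>.
  The equation for \<open>theta1\<close> is the stationarity condition of its imaginary part, whose
  value there is \<open>sin theta1\<close>; the centre is the point of the real axis directly
  below.\<close>

lemma taylor_q_1_le: "taylor_q 1 (sin theta1 / theta1) \<le> sin theta1"
proof (rule taylor_q_leI)
  fix x :: real assume x: "0 < x"
  define l where "l = sin theta1 / theta1"
  have th: "0 < theta1" using theta1_greater by simp
  have s: "0 < sin theta1" using th theta1_sign by (intro sin_gt_zero) auto
  have l_eq: "l * (1 + theta1\<^sup>2) = 2" "sin theta1 = l * theta1"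
  proof -
    have "l = 2 / (1 + theta1\<^sup>2)" using th by (simp add: l_def sin_theta1)
    moreover have "0 < 1 + theta1\<^sup>2" by (simp add: add_pos_nonneg)
    ultimately show "l * (1 + theta1\<^sup>2) = 2" using nonzero_eq_divide_eq[of "1 + theta1\<^sup>2" l 2] by simp
    show "sin theta1 = l * theta1" using th by (simp add: l_def)
  qed
  have "(norm (taylor_rem 1 x - of_real l * ((\<i> * of_real x) ^ 1 / fact 1)))\<^sup>2
      = (cos x - 1)\<^sup>2 + (sin x - l * x)\<^sup>2"
    by (simp add: taylor_rem_def cmod_power2 Re_exp Im_exp)
  also have "\<dots> = (sin theta1 * x)\<^sup>2 - 2 * (l * (1 - l) * x\<^sup>2 + l * x * sin x - 1 + cos x)"
  proof -
    have "(sin theta1 * x)\<^sup>2 = l * (l * (1 + theta1\<^sup>2) - l) * x\<^sup>2"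
      unfolding l_eq(2) by algebra
    moreover have "(cos x - 1)\<^sup>2 + (sin x - l * x)\<^sup>2
        = ((sin x)\<^sup>2 + (cos x)\<^sup>2) + 1 - 2 * cos x - 2 * l * x * sin x + l\<^sup>2 * x\<^sup>2"
      by algebra
    ultimately show ?thesis
      unfolding l_eq(1) sin_cos_squared_add by algebra
  qed
  also have "\<dots> \<le> (sin theta1 * x)\<^sup>2"
    using taylor_ratio_1_disc[OF x] by (simp add: l_def)
  finally have "norm (taylor_rem 1 x - of_real l * ((\<i> * of_real x) ^ 1 / fact 1)) \<le> sin theta1 * x"
    by (rule power2_le_imp_le) (use s x in auto)
  then show "norm (taylor_ratio 1 x - of_real l) \<le> sin theta1"
    using norm_taylor_ratio_diff[OF x, of 1 l] x by (simp add: field_simps)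
qed

subsection \<open>Characteristic functions\<close>

lemma norm_integral_le:
  fixes f :: "'a \<Rightarrow> complex"
  assumes "integrable M f" "integrable M g" "\<And>x. norm (f x) \<le> g x"
  shows "norm (\<integral>x. f x \<partial>M) \<le> (\<integral>x. g x \<partial>M)"
proof -
  have "norm (\<integral>x. f x \<partial>M) \<le> (\<integral>x. norm (f x) \<partial>M)" by (rule integral_norm_bound)
  also have "\<dots> \<le> (\<integral>x. g x \<partial>M)" using assms by (intro integral_mono) auto
  finally show ?thesis .
qed

lemma norm_iexp_increment_le:
  "norm (iexp (s * x) - iexp (t * x) - of_real (s - t) * (\<i> * of_real x * iexp (t * x)))
    \<le> (s - t)\<^sup>2 * (x\<^sup>2 / 2)"
proof -
  have "iexp (s * x) - iexp (t * x) - of_real (s - t) * (\<i> * of_real x * iexp (t * x))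
      = iexp (t * x) * taylor_rem 2 ((s - t) * x)"
  proof -
    have "iexp (s * x) = iexp (t * x) * iexp ((s - t) * x)"
      by (simp add: exp_add[symmetric] algebra_simps)
    then show ?thesis by (simp add: taylor_rem_def eval_nat_numeral algebra_simps)
  qed
  then show ?thesis
    using norm_taylor_rem_le[of 2 "(s - t) * x"]
    by (simp only: norm_mult norm_exp_i_times) (simp add: power_mult_distrib fact_numeral)
qed

text \<open>The second order remainder of \<open>exp\<close> is dominated by \<open>\<bar>g\<bar> * X\<^sup>2\<close> uniformly, so the
  difference quotients converge without an appeal to dominated convergence.\<close>

lemma has_vector_derivative_integral_iexp:
  fixes X :: "'a \<Rightarrow> real" and g :: "'a \<Rightarrow> complex"
  assumes [measurable]: "X \<in> borel_measurable M" "g \<in> borel_measurable M"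
    and int: "integrable M g" "integrable M (\<lambda>\<omega>. g \<omega> * of_real (X \<omega>))"
      "integrable M (\<lambda>\<omega>. g \<omega> * (of_real (X \<omega>))\<^sup>2)"
  shows "((\<lambda>t. \<integral>\<omega>. g \<omega> * iexp (t * X \<omega>) \<partial>M) has_vector_derivative
      (\<integral>\<omega>. g \<omega> * (\<i> * of_real (X \<omega>)) * iexp (t * X \<omega>) \<partial>M)) (at t)"
proof -
  define F where "F = (\<lambda>t. \<integral>\<omega>. g \<omega> * iexp (t * X \<omega>) \<partial>M)"
  define D where "D = (\<integral>\<omega>. g \<omega> * (\<i> * of_real (X \<omega>)) * iexp (t * X \<omega>) \<partial>M)"
  define C where "C = (\<integral>\<omega>. norm (g \<omega>) * ((X \<omega>)\<^sup>2 / 2) \<partial>M)"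
  have i1: "integrable M (\<lambda>\<omega>. g \<omega> * iexp (s * X \<omega>))" for s
    by (rule Bochner_Integration.integrable_bound[OF int(1)]) (auto simp: norm_mult)
  have i2: "integrable M (\<lambda>\<omega>. g \<omega> * (\<i> * of_real (X \<omega>)) * iexp (t * X \<omega>))"
    by (rule Bochner_Integration.integrable_bound[OF int(2)]) (auto simp: norm_mult)
  have i3: "integrable M (\<lambda>\<omega>. norm (g \<omega>) * ((X \<omega>)\<^sup>2 / 2))"
    by (rule Bochner_Integration.integrable_bound[OF int(3)]) (auto simp: norm_mult norm_power)
  have bound: "norm (F s - F t - (s - t) *\<^sub>R D) \<le> C * (s - t)\<^sup>2" for s
  proof -
    have "F s - F t - (s - t) *\<^sub>R D = (\<integral>\<omega>. g \<omega> * iexp (s * X \<omega>) - g \<omega> * iexp (t * X \<omega>)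
        - of_real (s - t) * (g \<omega> * (\<i> * of_real (X \<omega>)) * iexp (t * X \<omega>)) \<partial>M)"
      unfolding F_def D_def scaleR_conv_of_real using i1 i2
      by (simp only: Bochner_Integration.integral_diff Bochner_Integration.integrable_diff
          integral_mult_right_zero integrable_mult_right)
    also have "norm \<dots> \<le> (\<integral>\<omega>. (s - t)\<^sup>2 * (norm (g \<omega>) * ((X \<omega>)\<^sup>2 / 2)) \<partial>M)"
    proof (rule norm_integral_le)
      fix \<omega>
      have "norm (g \<omega> * iexp (s * X \<omega>) - g \<omega> * iexp (t * X \<omega>)
          - of_real (s - t) * (g \<omega> * (\<i> * of_real (X \<omega>)) * iexp (t * X \<omega>)))
        = norm (g \<omega>) * norm (iexp (s * X \<omega>) - iexp (t * X \<omega>)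
          - of_real (s - t) * (\<i> * of_real (X \<omega>) * iexp (t * X \<omega>)))"
        by (simp only: norm_mult[symmetric]) (simp add: algebra_simps)
      also have "\<dots> \<le> norm (g \<omega>) * ((s - t)\<^sup>2 * ((X \<omega>)\<^sup>2 / 2))"
        by (intro mult_left_mono norm_iexp_increment_le) auto
      finally show "norm (g \<omega> * iexp (s * X \<omega>) - g \<omega> * iexp (t * X \<omega>)
          - of_real (s - t) * (g \<omega> * (\<i> * of_real (X \<omega>)) * iexp (t * X \<omega>)))
        \<le> (s - t)\<^sup>2 * (norm (g \<omega>) * ((X \<omega>)\<^sup>2 / 2))"
        by (simp add: mult_ac)
    next
      show "integrable M (\<lambda>\<omega>. (s - t)\<^sup>2 * (norm (g \<omega>) * ((X \<omega>)\<^sup>2 / 2)))"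
        using i3 by (rule integrable_mult_right)
    qed (use i1 i2 in \<open>auto intro!: Bochner_Integration.integrable_diff\<close>)
    also have "\<dots> = C * (s - t)\<^sup>2" by (simp add: C_def)
    finally show ?thesis .
  qed
  have "0 \<le> C" unfolding C_def by (intro Bochner_Integration.integral_nonneg) auto
  have "(F has_derivative (\<lambda>h. h *\<^sub>R D)) (at t)"
  proof (rule has_derivativeI_sandwich[of 1])
    fix s :: real assume "s \<noteq> t"
    have "norm (F s - F t - (s - t) *\<^sub>R D) / norm (s - t) \<le> C * (s - t)\<^sup>2 / norm (s - t)"
      by (intro divide_right_mono bound) auto
    also have "\<dots> = C * \<bar>s - t\<bar>"
      using \<open>s \<noteq> t\<close> by (simp add: power2_eq_square abs_if field_simps)
    finally show "norm (F s - F t - (s - t) *\<^sub>R D) / norm (s - t) \<le> C * \<bar>s - t\<bar>" .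
  next
    have "((\<lambda>s. C * \<bar>s - t\<bar>) \<longlongrightarrow> C * \<bar>t - t\<bar>) (at t)"
      by (intro tendsto_intros)
    then show "((\<lambda>s. C * \<bar>s - t\<bar>) \<longlongrightarrow> 0) (at t)" by simp
  qed (auto intro: bounded_linear_scaleR_left)
  then show ?thesis by (simp add: has_vector_derivative_def F_def D_def)
qed

section \<open>Random variables of mean 0 and variance 1\<close>

locale standardized_rv = prob_space +
  fixes X :: "'a \<Rightarrow> real" and b :: real
  assumes X_measurable [measurable]: "X \<in> borel_measurable M"
    and third_integrable: "integrable M (\<lambda>\<omega>. \<bar>X \<omega>\<bar> ^ 3)"
    and mean_0: "(\<integral>\<omega>. X \<omega> \<partial>M) = 0" and variance_1: "(\<integral>\<omega>. (X \<omega>)\<^sup>2 \<partial>M) = 1"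
    and third_moment: "(\<integral>\<omega>. \<bar>X \<omega>\<bar> ^ 3 \<partial>M) = b" and b_ge_1: "1 \<le> b"
begin

text \<open>Domination by \<open>1 + \<bar>x\<bar> ^ 3\<close> on a probability space. The integral
  of a non-integrable function is 0 by convention, so this is what gives \<open>mean_0\<close> its
  intended meaning.\<close>

lemma power_integrable:
  assumes "m \<le> 3"
  shows "integrable M (\<lambda>\<omega>. X \<omega> ^ m)"
proof (rule Bochner_Integration.integrable_bound)
  show "integrable M (\<lambda>\<omega>. 1 + \<bar>X \<omega>\<bar> ^ 3)" using third_integrable by simp
  have "\<bar>x\<bar> ^ m \<le> 1 + \<bar>x\<bar> ^ 3" for x :: real
  proof (cases "\<bar>x\<bar> \<le> 1")
    case True
    then have "\<bar>x\<bar> ^ m \<le> 1" by (intro power_le_one) auto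
    then show ?thesis by (simp add: add_increasing2)
  next
    case False
    then have "\<bar>x\<bar> ^ m \<le> \<bar>x\<bar> ^ 3" using assms by (intro power_increasing) auto
    then show ?thesis by simp
  qed
  then show "AE \<omega> in M. norm (X \<omega> ^ m) \<le> norm (1 + \<bar>X \<omega>\<bar> ^ 3)"
    by (simp add: power_abs)
qed simp

lemma power_integrable_complex:
  assumes "m \<le> 3"
  shows "integrable M (\<lambda>\<omega>. of_real (X \<omega>) ^ m :: complex)"
  using integrable_of_real[OF power_integrable[OF assms], where 'a = complex] by simp

lemma power_iexp_integrable:
  assumes "m \<le> 3"
  shows "integrable M (\<lambda>\<omega>. of_real (X \<omega>) ^ m * iexp (t * X \<omega>))"
  by (rule Bochner_Integration.integrable_bound[OF power_integrable[OF assms]])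
     (auto simp: norm_mult norm_power power_abs)

text \<open>The second order error needs \<open>m + 2\<close> moments, and three are available,
  whence \<open>m \<le> 1\<close>. This covers the first two derivatives.\<close>

lemma power_iexp_has_derivative:
  assumes "m \<le> 1"
  shows "((\<lambda>t. \<integral>\<omega>. of_real (X \<omega>) ^ m * iexp (t * X \<omega>) \<partial>M) has_vector_derivative
    \<i> * (\<integral>\<omega>. of_real (X \<omega>) ^ Suc m * iexp (t * X \<omega>) \<partial>M)) (at t)"
proof -
  have "((\<lambda>t. \<integral>\<omega>. of_real (X \<omega>) ^ m * iexp (t * X \<omega>) \<partial>M) has_vector_derivative
    (\<integral>\<omega>. of_real (X \<omega>) ^ m * (\<i> * of_real (X \<omega>)) * iexp (t * X \<omega>) \<partial>M)) (at t)"
  proof (rule has_vector_derivative_integral_iexp)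
    show "integrable M (\<lambda>\<omega>. of_real (X \<omega>) ^ m :: complex)"
      using assms by (intro power_integrable_complex) simp
    show "integrable M (\<lambda>\<omega>. of_real (X \<omega>) ^ m * of_real (X \<omega>) :: complex)"
      using assms power_integrable_complex[of "Suc m"] by (simp add: mult.commute)
    show "integrable M (\<lambda>\<omega>. of_real (X \<omega>) ^ m * (of_real (X \<omega>))\<^sup>2 :: complex)"
      using assms power_integrable_complex[of "m + 2"] by (simp only: power_add)
  qed auto
  also have "(\<integral>\<omega>. of_real (X \<omega>) ^ m * (\<i> * of_real (X \<omega>)) * iexp (t * X \<omega>) \<partial>M)
      = (\<integral>\<omega>. \<i> * (of_real (X \<omega>) ^ Suc m * iexp (t * X \<omega>)) \<partial>M)"
    by (simp add: mult_ac)
  also have "\<dots> = \<i> * (\<integral>\<omega>. of_real (X \<omega>) ^ Suc m * iexp (t * X \<omega>) \<partial>M)"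
    by (rule integral_mult_right_zero)
  finally show ?thesis .
qed

lemma third_moment_le: "\<bar>\<integral>\<omega>. X \<omega> ^ 3 \<partial>M\<bar> \<le> b * A_coeff b"
  using abs_third_moment_le[of X b] power_integrable[of 1] power_integrable[of 2]
    third_integrable mean_0 variance_1 third_moment b_ge_1 by simp

lemma power_taylor_rem_integrable:
  assumes "m + n = 3"
  shows "integrable M (\<lambda>\<omega>. of_real (X \<omega>) ^ m * taylor_rem n (t * X \<omega>))"
proof (rule Bochner_Integration.integrable_bound)
  show "integrable M (\<lambda>\<omega>. \<bar>t\<bar> ^ n / fact n * \<bar>X \<omega>\<bar> ^ 3)"
    using third_integrable by simp
  show "(\<lambda>\<omega>. of_real (X \<omega>) ^ m * taylor_rem n (t * X \<omega>)) \<in> borel_measurable M"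
    unfolding taylor_rem_def by measurable
  have "norm (of_real x ^ m * taylor_rem n (t * x)) \<le> \<bar>t\<bar> ^ n / fact n * \<bar>x\<bar> ^ 3" for x
  proof -
    have "norm (of_real x ^ m * taylor_rem n (t * x)) \<le> \<bar>x\<bar> ^ m * (\<bar>t * x\<bar> ^ n / fact n)"
      unfolding norm_mult norm_power norm_of_real
      by (intro mult_left_mono norm_taylor_rem_le) auto
    also have "\<dots> = \<bar>t\<bar> ^ n / fact n * \<bar>x\<bar> ^ (m + n)"
      by (simp add: abs_mult power_mult_distrib power_add)
    finally show ?thesis by (simp only: assms)
  qed
  then show "AE \<omega> in M. norm (of_real (X \<omega>) ^ m * taylor_rem n (t * X \<omega>))
      \<le> norm (\<bar>t\<bar> ^ n / fact n * \<bar>X \<omega>\<bar> ^ 3)"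
    by simp
qed

text \<open>The admissible \<open>l\<close> shift part of the remainder to \<open>E X\<^sup>3\<close>, where the bound
  \<open>third_moment_le\<close> is better than \<open>b\<close>.\<close>

lemma norm_integral_taylor_rem_le:
  assumes mn: "m + n = 3" and n: "n \<ge> 1"
  shows "norm (\<integral>\<omega>. of_real (X \<omega>) ^ m * taylor_rem n (t * X \<omega>) \<partial>M)
    \<le> b * gamma_coeff n b * (\<bar>t\<bar> ^ n / fact n)"
proof -
  obtain l where l: "l \<in> {lambda_lower n..lambda_upper n}"
      "gamma_coeff n b = l * A_coeff b + taylor_q n l"
    using gamma_coeff_attained[OF n, of b] by metis
  have l0: "0 \<le> l" using l lambda_lower_props(1)[OF n] by auto
  \<comment> \<open>Since \<open>m + n = 3\<close>, multiplying the subtracted multiple of the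
    \<open>n\<close>-th Taylor term at \<open>t * x\<close> by \<open>x ^ m\<close> gives exactly
    \<open>c * x ^ 3\<close>.\<close>
  define c where "c = of_real l * (\<i> * of_real t) ^ n / fact n"
  define T where "T = \<bar>t\<bar> ^ n / fact n"
  have T: "0 \<le> T" by (simp add: T_def)
  have i1: "integrable M (\<lambda>\<omega>. of_real (X \<omega>) ^ m * taylor_rem n (t * X \<omega>))"
    by (rule power_taylor_rem_integrable[OF mn])
  have i2: "integrable M (\<lambda>\<omega>. c * of_real (X \<omega>) ^ 3)"
    using power_integrable_complex[of 3] by simp
  have split: "(\<integral>\<omega>. of_real (X \<omega>) ^ m * taylor_rem n (t * X \<omega>) \<partial>M)
      = (\<integral>\<omega>. of_real (X \<omega>) ^ m * taylor_rem n (t * X \<omega>) - c * of_real (X \<omega>) ^ 3 \<partial>M)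
        + c * of_real (\<integral>\<omega>. X \<omega> ^ 3 \<partial>M)"
    using i1 i2 by (simp flip: of_real_power)
  have pt: "norm (of_real x ^ m * taylor_rem n (t * x) - c * of_real x ^ 3)
      \<le> taylor_q n l * T * \<bar>x\<bar> ^ 3" for x
  proof -
    have "of_real x ^ m * taylor_rem n (t * x) - c * of_real x ^ 3
        = of_real x ^ m * (taylor_rem n (t * x) - of_real l * ((\<i> * of_real (t * x)) ^ n / fact n))"
      unfolding mn[symmetric] by (simp add: c_def power_add power_mult_distrib algebra_simps)
    then have "norm (of_real x ^ m * taylor_rem n (t * x) - c * of_real x ^ 3)
        \<le> \<bar>x\<bar> ^ m * (taylor_q n l * (\<bar>t * x\<bar> ^ n / fact n))"
      using mult_left_mono[OF norm_taylor_rem_diff_le[OF n, of "t * x" l], of "\<bar>x\<bar> ^ m"]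
      by (simp only: norm_mult norm_power norm_of_real) simp
    also have "\<dots> = taylor_q n l * T * \<bar>x\<bar> ^ (m + n)"
      by (simp add: T_def abs_mult power_mult_distrib power_add)
    finally show ?thesis by (simp only: mn)
  qed
  have "norm (\<integral>\<omega>. of_real (X \<omega>) ^ m * taylor_rem n (t * X \<omega>) - c * of_real (X \<omega>) ^ 3 \<partial>M)
      \<le> (\<integral>\<omega>. taylor_q n l * T * \<bar>X \<omega>\<bar> ^ 3 \<partial>M)"
    using i1 i2 third_integrable pt by (intro norm_integral_le) auto
  also have "\<dots> = taylor_q n l * T * b" by (simp add: third_moment)
  finally have 1: "norm (\<integral>\<omega>. of_real (X \<omega>) ^ m * taylor_rem n (t * X \<omega>) - c * of_real (X \<omega>) ^ 3 \<partial>M)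
      \<le> taylor_q n l * T * b" .
  have "norm (c * of_real (\<integral>\<omega>. X \<omega> ^ 3 \<partial>M)) = l * T * \<bar>\<integral>\<omega>. X \<omega> ^ 3 \<partial>M\<bar>"
    using l0 by (simp add: c_def T_def norm_mult norm_divide norm_power)
  also have "\<dots> \<le> l * T * (b * A_coeff b)"
    using l0 T third_moment_le by (intro mult_left_mono) auto
  finally have 2: "norm (c * of_real (\<integral>\<omega>. X \<omega> ^ 3 \<partial>M)) \<le> l * T * (b * A_coeff b)" .
  have "norm (\<integral>\<omega>. of_real (X \<omega>) ^ m * taylor_rem n (t * X \<omega>) \<partial>M)
      \<le> taylor_q n l * T * b + l * T * (b * A_coeff b)"
    unfolding split using 1 2 by (intro norm_triangle_le) auto
  also have "\<dots> = b * gamma_coeff n b * T" by (simp add: l(2) algebra_simps)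
  finally show ?thesis by (simp add: T_def)
qed

lemma char_distr: "char (distr M borel X) t = (\<integral>\<omega>. of_real (X \<omega>) ^ 0 * iexp (t * X \<omega>) \<partial>M)"
  by (simp add: char_def integral_distr)

lemma char_bounds:
  assumes f: "f = char (distr M borel X)"
    and f': "f' = (\<lambda>t. vector_derivative f (at t))"
    and f'': "f'' = (\<lambda>t. vector_derivative f' (at t))"
  shows "f differentiable (at t)" "f' differentiable (at t)"
    and "norm (f t - 1 + of_real (t\<^sup>2 / 2)) \<le> b * gamma_coeff 3 b * \<bar>t\<bar> ^ 3 / 6"
    and "norm (f' t + of_real t) \<le> b * gamma_coeff 2 b * t\<^sup>2 / 2"
    and "norm (f'' t + 1) \<le> b * gamma_coeff 1 b * \<bar>t\<bar>"
    and "norm (f t - 1) \<le> (1 - cos theta1) / theta1 * (\<integral>\<omega>. \<bar>t * X \<omega>\<bar> \<partial>M)"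
proof -
  \<comment> \<open>\<open>f\<close>, \<open>f'\<close>, \<open>f''\<close> are \<open>G 0\<close>,
    \<open>\<i> * G 1\<close>, \<open>- G 2\<close>. With the prescribed moments, subtracting their
    Taylor polynomials amounts to replacing \<open>iexp\<close> in \<open>G m\<close> by
    \<open>taylor_rem (3 - m)\<close>.\<close>
  define G where "G = (\<lambda>m t. \<integral>\<omega>. of_real (X \<omega>) ^ m * iexp (t * X \<omega>) \<partial>M)"
  have fG: "f = G 0" by (simp add: f G_def fun_eq_iff char_distr)
  have d: "(f has_vector_derivative \<i> * G 1 t) (at t)" for t
    using power_iexp_has_derivative[of 0 t] unfolding fG G_def by simp
  have f'G: "f' = (\<lambda>t. \<i> * G 1 t)" by (simp add: f' vector_derivative_at[OF d])
  have d': "(f' has_vector_derivative - G 2 t) (at t)" for t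
    using has_vector_derivative_mult_right[OF power_iexp_has_derivative[of 1 t], of \<i>]
    unfolding f'G G_def by (simp add: numeral_2_eq_2 mult.assoc[symmetric])
  have f''G: "f'' = (\<lambda>t. - G 2 t)" by (simp add: f'' vector_derivative_at[OF d'])
  show "f differentiable (at t)" "f' differentiable (at t)"
    using d d' by (auto simp: has_vector_derivative_def differentiable_def)
  have i0: "integrable M (\<lambda>\<omega>. iexp (t * X \<omega>))" using power_iexp_integrable[of 0 t] by simp
  have i1: "integrable M (\<lambda>\<omega>. of_real (X \<omega>) * iexp (t * X \<omega>))" using power_iexp_integrable[of 1 t] by simp
  have i2: "integrable M (\<lambda>\<omega>. (of_real (X \<omega>))\<^sup>2 * iexp (t * X \<omega>))" using power_iexp_integrable[of 2 t] by simp
  have j1: "integrable M (\<lambda>\<omega>. of_real (X \<omega>) :: complex)" using power_integrable_complex[of 1] by simp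
  have j2: "integrable M (\<lambda>\<omega>. (of_real (X \<omega>))\<^sup>2 :: complex)" using power_integrable_complex[of 2] by simp
  have m2: "(\<integral>\<omega>. (of_real (X \<omega>))\<^sup>2 \<partial>M) = (1 :: complex)"
    using variance_1 by (simp flip: of_real_power)
  have "(\<integral>\<omega>. of_real (X \<omega>) ^ 0 * taylor_rem 3 (t * X \<omega>) \<partial>M)
      = (\<integral>\<omega>. iexp (t * X \<omega>) - 1 - \<i> * of_real t * of_real (X \<omega>) + of_real (t\<^sup>2 / 2) * (of_real (X \<omega>))\<^sup>2 \<partial>M)"
    by (intro Bochner_Integration.integral_cong)
       (simp_all add: taylor_rem_def eval_nat_numeral power_mult_distrib)
  also have "\<dots> = f t - 1 + of_real (t\<^sup>2 / 2)"
    using i0 j1 j2 by (simp add: mean_0 m2 fG G_def prob_space)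
  finally show "norm (f t - 1 + of_real (t\<^sup>2 / 2)) \<le> b * gamma_coeff 3 b * \<bar>t\<bar> ^ 3 / 6"
    using norm_integral_taylor_rem_le[of 0 3 t] by (simp add: fact_numeral)
  have "(\<integral>\<omega>. of_real (X \<omega>) ^ 1 * taylor_rem 2 (t * X \<omega>) \<partial>M)
      = (\<integral>\<omega>. of_real (X \<omega>) * iexp (t * X \<omega>) - of_real (X \<omega>) - \<i> * of_real t * (of_real (X \<omega>))\<^sup>2 \<partial>M)"
    by (intro Bochner_Integration.integral_cong)
       (simp_all add: taylor_rem_def eval_nat_numeral algebra_simps)
  also have "\<dots> = G 1 t - \<i> * of_real t"
    using i1 j1 j2 by (simp add: mean_0 m2 G_def)
  finally have "norm (G 1 t - \<i> * of_real t) \<le> b * gamma_coeff 2 b * t\<^sup>2 / 2"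
    using norm_integral_taylor_rem_le[of 1 2 t] by (simp add: fact_numeral)
  moreover have "f' t + of_real t = \<i> * (G 1 t - \<i> * of_real t)"
    by (simp add: f'G right_diff_distrib mult.assoc[symmetric])
  ultimately show "norm (f' t + of_real t) \<le> b * gamma_coeff 2 b * t\<^sup>2 / 2"
    by (simp add: norm_mult)
  have "(\<integral>\<omega>. of_real (X \<omega>) ^ 2 * taylor_rem 1 (t * X \<omega>) \<partial>M)
      = (\<integral>\<omega>. (of_real (X \<omega>))\<^sup>2 * iexp (t * X \<omega>) - (of_real (X \<omega>))\<^sup>2 \<partial>M)"
    by (intro Bochner_Integration.integral_cong) (simp_all add: taylor_rem_def algebra_simps)
  also have "\<dots> = G 2 t - 1"
    using i2 j2 by (simp add: m2 G_def)
  finally have "norm (G 2 t - 1) \<le> b * gamma_coeff 1 b * \<bar>t\<bar>"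
    using norm_integral_taylor_rem_le[of 2 1 t] by simp
  then show "norm (f'' t + 1) \<le> b * gamma_coeff 1 b * \<bar>t\<bar>"
    by (simp add: f''G norm_minus_commute)
  \<comment> \<open>As the mean is 0, any multiple of \<open>X\<close> may be subtracted under the
    integral; this \<open>l\<close> is the centre of the disc in
    \<open>taylor_q_1_le\<close>.\<close>
  define l where "l = sin theta1 / theta1"
  have "f t - 1 = (\<integral>\<omega>. iexp (t * X \<omega>) - 1 - of_real l * \<i> * of_real t * of_real (X \<omega>) \<partial>M)"
    using i0 j1 by (simp add: mean_0 fG G_def prob_space)
  also have "norm \<dots> \<le> (\<integral>\<omega>. sin theta1 * \<bar>t * X \<omega>\<bar> \<partial>M)"
  proof (rule norm_integral_le)
    fix \<omega>
    have "norm (iexp (t * X \<omega>) - 1 - of_real l * \<i> * of_real t * of_real (X \<omega>))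
        \<le> taylor_q 1 l * \<bar>t * X \<omega>\<bar>"
      using norm_taylor_rem_diff_le[of 1 "t * X \<omega>" l] by (simp add: taylor_rem_def mult_ac)
    also have "\<dots> \<le> sin theta1 * \<bar>t * X \<omega>\<bar>"
      using taylor_q_1_le by (intro mult_right_mono) (auto simp: l_def)
    finally show "norm (iexp (t * X \<omega>) - 1 - of_real l * \<i> * of_real t * of_real (X \<omega>))
        \<le> sin theta1 * \<bar>t * X \<omega>\<bar>" .
  qed (use i0 j1 power_integrable[of 1] in auto)
  also have "\<dots> = (1 - cos theta1) / theta1 * (\<integral>\<omega>. \<bar>t * X \<omega>\<bar> \<partial>M)"
    by (simp add: theta1_ratio_eq)
  finally show "norm (f t - 1) \<le> (1 - cos theta1) / theta1 * (\<integral>\<omega>. \<bar>t * X \<omega>\<bar> \<partial>M)" .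
qed

lemma theta1_first_moment_le:
  "(1 - cos theta1) / theta1 * (\<integral>\<omega>. \<bar>t * X \<omega>\<bar> \<partial>M) \<le> 0.7247 * \<bar>t\<bar> * (\<integral>\<omega>. \<bar>X \<omega>\<bar> \<partial>M)"
proof -
  have "(\<integral>\<omega>. \<bar>t * X \<omega>\<bar> \<partial>M) = \<bar>t\<bar> * (\<integral>\<omega>. \<bar>X \<omega>\<bar> \<partial>M)" by (simp add: abs_mult)
  moreover have "0 \<le> \<bar>t\<bar> * (\<integral>\<omega>. \<bar>X \<omega>\<bar> \<partial>M)" by simp
  ultimately show ?thesis
    unfolding theta1_ratio_eq using sin_theta1_le mult_right_mono by (metis mult.assoc)
qed

end

theorem corollary1:
  shows
    "(\<forall>b\<ge>1. \<forall>(M :: 'a measure) X f f' f''.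
        prob_space M \<and> X \<in> borel_measurable M
        \<and> integrable M (\<lambda>\<omega>. \<bar>X \<omega>\<bar> ^ 3)
        \<and> (\<integral>\<omega>. X \<omega> \<partial>M) = 0 \<and> (\<integral>\<omega>. (X \<omega>)\<^sup>2 \<partial>M) = 1 \<and> (\<integral>\<omega>. \<bar>X \<omega>\<bar> ^ 3 \<partial>M) = b
        \<and> f = char (distr M borel X)
        \<and> f' = (\<lambda>t. vector_derivative f (at t))
        \<and> f'' = (\<lambda>t. vector_derivative f' (at t))
        \<longrightarrow>
        (\<forall>t::real.
           f differentiable (at t) \<and> f' differentiable (at t)
           \<and> norm (f t - 1 + of_real (t\<^sup>2 / 2)) \<le> b * gamma_coeff 3 b * \<bar>t\<bar> ^ 3 / 6
           \<and> norm (f' t + of_real t) \<le> b * gamma_coeff 2 b * t\<^sup>2 / 2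
           \<and> norm (f'' t + 1) \<le> b * gamma_coeff 1 b * \<bar>t\<bar>
           \<and> norm (f t - 1) \<le> (1 - cos theta1) / theta1 * (\<integral>\<omega>. \<bar>t * X \<omega>\<bar> \<partial>M)
           \<and> (1 - cos theta1) / theta1 * (\<integral>\<omega>. \<bar>t * X \<omega>\<bar> \<partial>M)
               \<le> 0.7247 * \<bar>t\<bar> * (\<integral>\<omega>. \<bar>X \<omega>\<bar> \<partial>M)))
     \<and> (\<forall>n\<in>{1, 2, 3 :: nat}.
          (\<forall>b\<ge>1. \<exists>l\<in>{lambda_lower n..lambda_upper n}.
              gamma_coeff n b = l * A_coeff b + taylor_q n l)
          \<and> concave_on {1..} (\<lambda>b. b * gamma_coeff n b)
          \<and> strict_mono_on {1..} (\<lambda>b. b * gamma_coeff n b)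
          \<and> concave_on {1..} (gamma_coeff n)
          \<and> strict_mono_on {1..} (gamma_coeff n)
          \<and> taylor_q n (lambda_upper n) = gamma_coeff n 1
          \<and> (\<forall>b\<ge>1. gamma_coeff n 1 \<le> gamma_coeff n b \<and> gamma_coeff n b < 1)
          \<and> (gamma_coeff n \<longlongrightarrow> 1) at_top)"
proof (intro conjI allI impI ballI)
  fix b :: real and M :: "'a measure" and X f f' f'' and t :: real
  assume b: "1 \<le> b" and
    h: "prob_space M \<and> X \<in> borel_measurable M
        \<and> integrable M (\<lambda>\<omega>. \<bar>X \<omega>\<bar> ^ 3)
        \<and> (\<integral>\<omega>. X \<omega> \<partial>M) = 0 \<and> (\<integral>\<omega>. (X \<omega>)\<^sup>2 \<partial>M) = 1 \<and> (\<integral>\<omega>. \<bar>X \<omega>\<bar> ^ 3 \<partial>M) = b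
        \<and> f = char (distr M borel X)
        \<and> f' = (\<lambda>t. vector_derivative f (at t))
        \<and> f'' = (\<lambda>t. vector_derivative f' (at t))"
  interpret prob_space M using h by blast
  interpret standardized_rv M X b
    by standard (use b h in auto)
  have ff: "f = char (distr M borel X)" "f' = (\<lambda>t. vector_derivative f (at t))"
    "f'' = (\<lambda>t. vector_derivative f' (at t))" using h by blast+
  show "f differentiable (at t)" "f' differentiable (at t)"
    "norm (f t - 1 + of_real (t\<^sup>2 / 2)) \<le> b * gamma_coeff 3 b * \<bar>t\<bar> ^ 3 / 6"
    "norm (f' t + of_real t) \<le> b * gamma_coeff 2 b * t\<^sup>2 / 2"
    "norm (f'' t + 1) \<le> b * gamma_coeff 1 b * \<bar>t\<bar>"
    "norm (f t - 1) \<le> (1 - cos theta1) / theta1 * (\<integral>\<omega>. \<bar>t * X \<omega>\<bar> \<partial>M)"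
    by (rule char_bounds[OF ff])+
  show "(1 - cos theta1) / theta1 * (\<integral>\<omega>. \<bar>t * X \<omega>\<bar> \<partial>M)
      \<le> 0.7247 * \<bar>t\<bar> * (\<integral>\<omega>. \<bar>X \<omega>\<bar> \<partial>M)"
    by (rule theta1_first_moment_le)
next
  fix n :: nat assume "n \<in> {1, 2, 3}"
  then have n: "n \<ge> 1" by auto
  show "\<exists>l\<in>{lambda_lower n..lambda_upper n}. gamma_coeff n b = l * A_coeff b + taylor_q n l" for b
    using gamma_coeff_attained[OF n, of b] by metis
  show "concave_on {1..} (\<lambda>b. b * gamma_coeff n b)" "concave_on {1..} (gamma_coeff n)"
    using concave_on_gamma_coeff[OF n] by auto
  show "strict_mono_on {1..} (\<lambda>b. b * gamma_coeff n b)"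
    by (intro strict_mono_onI mult_gamma_coeff_strict_mono n) auto
  show "strict_mono_on {1..} (gamma_coeff n)"
    by (intro strict_mono_onI gamma_coeff_strict_mono n) auto
  show "taylor_q n (lambda_upper n) = gamma_coeff n 1" by (rule gamma_coeff_1[OF n, symmetric])
  show "gamma_coeff n 1 \<le> gamma_coeff n b" if "1 \<le> b" for b
    using gamma_coeff_strict_mono[OF n, of 1 b] that by (cases "b = 1") auto
  show "gamma_coeff n b < 1" if "1 \<le> b" for b by (rule gamma_coeff_less_1[OF n that])
  show "(gamma_coeff n \<longlongrightarrow> 1) at_top" by (rule gamma_coeff_tendsto[OF n])
qed

end
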